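(* Let $n, d\ge 1$ be integers, let $X(n,d)$ be the affine algebraic variety of all polynomial mappings $F:\mathbb{C}^n\to\mathbb{C}^n$ of degree at most $d$ with $\mathrm{Jac}(F)=1$, and let $Y$ be an irreducible component of $X(n,d)$. Then either every element of $Y$ is a polynomial automorphism of $\mathbb{C}^n$, or a generic element of $Y$ is a counterexample to the Jacobian Conjecture (that is, there is a nonempty Zariski open, hence dense, subset $U\subset Y$ such that no $F\in U$ is a polynomial automorphism). Moreover, $\dim Y\ge n^2-1$.
   Context: A polynomial mapping $F=(F_1,\dots,F_n):\mathbb{C}^n\to\mathbb{C}^n$ has degree at most $d$ if every component $F_i\in\mathbb{C}[x_1,\dots,x_n]$ has total degree at most $d$. The space $\Omega(n,d)$ of all such mappings is identified with an affine space $\mathbb{C}^M$ via the coefficients of the components. $\mathrm{Jac}(F)=\det(\partial F_i/\partial x_j)_{i,j}\in\mathbb{C}[x_1,\dots,x_n]$, and $\mathrm{Jac}(F)=1$ means that it is the constant polynomial $1$. $X(n,d)=\{F\in\Omega(n,d):\mathrm{Jac}(F)=1\}$ is a Zariski closed subset of $\Omega(n,d)\cong\mathbb{C}^M$ (an affine algebraic variety, possibly reducible), with the induced Zariski topology. A polynomial automorphism of $\mathbb{C}^n$ is a polynomial mapping $\mathbb{C}^n\to\mathbb{C}^n$ that has a two-sided inverse which is also a polynomial mapping (of any degree). A counterexample to the Jacobian Conjecture in $X(n,d)$ is an element $F\in X(n,d)$ that is not a polynomial automorphism. "A generic element of $Y$ has property $P$" means that $P$ holds for all elements of some nonempty Zariski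 open subset of the irreducible variety $Y$. *)

theory Defs
  imports
    "HOL-Library.Poly_Mapping"
    "HOL-Library.Extended_Nat"
    "HOL-Analysis.Abstract_Topology"
    "Jordan_Normal_Form.Determinant"
begin

text \<open>Multivariate polynomials over \<open>'a\<close> with variables in \<open>'v\<close>: finitely supported maps from
  monomials (exponent vectors) to coefficients, with the convolution product of
  \<^theory>\<open>HOL-Library.Poly_Mapping\<close>.\<close>

type_synonym ('v, 'a) mpol = "('v \<Rightarrow>\<^sub>0 nat) \<Rightarrow>\<^sub>0 'a"

definition mpol_vars :: "('v, 'a::zero) mpol \<Rightarrow> 'v set" where
  "mpol_vars p = (\<Union>m\<in>Poly_Mapping.keys p. Poly_Mapping.keys m)"

definition mon_deg :: "('v \<Rightarrow>\<^sub>0 nat) \<Rightarrow> nat" where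
  "mon_deg m = (\<Sum>v\<in>Poly_Mapping.keys m. Poly_Mapping.lookup m v)"

text \<open>The zero polynomial gets total degree 0.\<close>

definition total_deg :: "('v, 'a::zero) mpol \<Rightarrow> nat" where
  "total_deg p = Max (insert 0 (mon_deg ` Poly_Mapping.keys p))"

definition mon_eval :: "('v \<Rightarrow> 'a::comm_semiring_1) \<Rightarrow> ('v \<Rightarrow>\<^sub>0 nat) \<Rightarrow> 'a" where
  "mon_eval x m = (\<Prod>v\<in>Poly_Mapping.keys m. x v ^ Poly_Mapping.lookup m v)"

definition mpol_eval :: "('v \<Rightarrow> 'a::comm_semiring_1) \<Rightarrow> ('v, 'a) mpol \<Rightarrow> 'a" where
  "mpol_eval x p = (\<Sum>m\<in>Poly_Mapping.keys p. Poly_Mapping.lookup p m * mon_eval x m)"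

text \<open>Formal partial derivative. When the exponent of \<open>v\<close> in \<open>m\<close> is 0 the subtraction truncates,
  but then the coefficient vanishes.\<close>

definition mpol_pderiv :: "'v \<Rightarrow> ('v, 'a::comm_semiring_1) mpol \<Rightarrow> ('v, 'a) mpol" where
  "mpol_pderiv v p = (\<Sum>m\<in>Poly_Mapping.keys p.
     Poly_Mapping.single (m - Poly_Mapping.single v 1)
       (of_nat (Poly_Mapping.lookup m v) * Poly_Mapping.lookup p m))"


section \<open>Polynomial mappings\<close>

text \<open>A polynomial mapping from \<open>\<complex>\<^sup>n\<close> to itself is given by its \<open>n\<close> components in
  \<open>\<complex>[x\<^sub>0, \<dots>, x\<^sub>n\<^sub>-\<^sub>1]\<close>.\<close>

type_synonym polymap = "(nat, complex) mpol vec"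

definition polymaps :: "nat \<Rightarrow> polymap set" where
  "polymaps n = {F \<in> carrier_vec n. \<forall>i<n. mpol_vars (F $ i) \<subseteq> {..<n}}"

definition polymap_apply :: "polymap \<Rightarrow> complex vec \<Rightarrow> complex vec" where
  "polymap_apply F x = vec (dim_vec F) (\<lambda>i. mpol_eval (\<lambda>j. x $ j) (F $ i))"

definition poly_automorphism :: "nat \<Rightarrow> polymap \<Rightarrow> bool" where
  "poly_automorphism n F \<longleftrightarrow> F \<in> polymaps n \<and>
     (\<exists>G\<in>polymaps n. \<forall>x\<in>carrier_vec n.
        polymap_apply G (polymap_apply F x) = x \<and> polymap_apply F (polymap_apply G x) = x)"

definition Jac :: "polymap \<Rightarrow> (nat, complex) mpol" where
  "Jac F = det (mat (dim_vec F) (dim_vec F) (\<lambda>(i, j). mpol_pderiv j (F $ i)))"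

definition Omega :: "nat \<Rightarrow> nat \<Rightarrow> polymap set" where
  "Omega n d = {F \<in> polymaps n. \<forall>i<n. total_deg (F $ i) \<le> d}"

definition Keller :: "nat \<Rightarrow> nat \<Rightarrow> polymap set" where
  "Keller n d = {F \<in> Omega n d. Jac F = 1}"

definition JC_counterexample :: "nat \<Rightarrow> nat \<Rightarrow> polymap \<Rightarrow> bool" where
  "JC_counterexample n d F \<longleftrightarrow> F \<in> Keller n d \<and> \<not> poly_automorphism n F"


section \<open>The Zariski topology on the coefficient space\<close>

text \<open>The coordinates of \<open>Omega n d\<close> are the coefficients of the components: the coordinate
  \<open>(i, m)\<close> is the coefficient of the monomial \<open>m\<close> in the \<open>i\<close>-th component.\<close>

type_synonym coord = "nat \<times> (nat \<Rightarrow>\<^sub>0 nat)"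

definition coords :: "nat \<Rightarrow> nat \<Rightarrow> coord set" where
  "coords n d = {..<n} \<times> {m. Poly_Mapping.keys m \<subseteq> {..<n} \<and> mon_deg m \<le> d}"

definition coeff_vec :: "polymap \<Rightarrow> coord \<Rightarrow> complex" where
  "coeff_vec F = (\<lambda>(i, m). Poly_Mapping.lookup (F $ i) m)"

definition coord_polys :: "nat \<Rightarrow> nat \<Rightarrow> (coord, complex) mpol set" where
  "coord_polys n d = {P. mpol_vars P \<subseteq> coords n d}"

definition zero_locus :: "nat \<Rightarrow> nat \<Rightarrow> (coord, complex) mpol set \<Rightarrow> polymap set" where
  "zero_locus n d S = {F \<in> Omega n d. \<forall>P\<in>S. mpol_eval (coeff_vec F) P = 0}"

definition zariski :: "nat \<Rightarrow> nat \<Rightarrow> polymap topology" where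
  "zariski n d = topology (\<lambda>U. \<exists>S\<subseteq>coord_polys n d. U = Omega n d - zero_locus n d S)"


section \<open>Irreducibility and dimension\<close>

definition irreducible_in :: "'a topology \<Rightarrow> 'a set \<Rightarrow> bool" where
  "irreducible_in T S \<longleftrightarrow> S \<subseteq> topspace T \<and> S \<noteq> {} \<and>
     (\<forall>A B. closedin T A \<and> closedin T B \<and> S \<subseteq> A \<union> B \<longrightarrow> S \<subseteq> A \<or> S \<subseteq> B)"

definition irreducible_component_of :: "'a topology \<Rightarrow> 'a set \<Rightarrow> bool" where
  "irreducible_component_of T Y \<longleftrightarrow> irreducible_in T Y \<and>
     (\<forall>Z. irreducible_in T Z \<and> Y \<subseteq> Z \<longrightarrow> Z = Y)"

text \<open>Krull dimension: the supremum of the lengths \<open>k\<close> of chains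
  \<open>Z\<^sub>0 \<subset> Z\<^sub>1 \<subset> \<dots> \<subset> Z\<^sub>k\<close> of irreducible closed subsets (0 for the empty space).\<close>

definition krull_dim :: "'a topology \<Rightarrow> enat" where
  "krull_dim T = (SUP k \<in> {k. \<exists>Z. (\<forall>i\<le>k. closedin T (Z i) \<and> irreducible_in T (Z i)) \<and>
                                  (\<forall>i<k. Z i \<subset> Z (Suc i))}. enat k)"


section \<open>The Zariski topology is a topology\<close>

lemma mpol_eval_superset:
  assumes "finite A" "Poly_Mapping.keys p \<subseteq> A"
  shows "mpol_eval x p = (\<Sum>m\<in>A. Poly_Mapping.lookup p m * mon_eval x m)"
  unfolding mpol_eval_def
  using assms by (intro sum.mono_neutral_left) (auto simp: in_keys_iff)

lemma mpol_eval_0 [simp]: "mpol_eval x 0 = 0"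
  by (simp add: mpol_eval_def)

lemma mpol_eval_1 [simp]: "mpol_eval x 1 = 1"
  by (simp add: mpol_eval_def mon_eval_def)

lemma mpol_eval_add: "mpol_eval x (p + q) = mpol_eval x p + mpol_eval x q"
proof -
  let ?A = "Poly_Mapping.keys p \<union> Poly_Mapping.keys q"
  have "Poly_Mapping.keys (p + q) \<subseteq> ?A"
    by (rule Poly_Mapping.keys_add)
  then show ?thesis
    by (simp add: mpol_eval_superset[of ?A] lookup_add algebra_simps sum.distrib)
qed

lemma mpol_eval_sum: "mpol_eval x (sum f A) = (\<Sum>a\<in>A. mpol_eval x (f a))"
  by (induction A rule: infinite_finite_induct) (auto simp: mpol_eval_add)

lemma mpol_eval_single: "mpol_eval x (Poly_Mapping.single m c) = c * mon_eval x m"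
  by (cases "c = 0") (auto simp: mpol_eval_def)

lemma mon_eval_superset:
  assumes "finite A" "Poly_Mapping.keys m \<subseteq> A"
  shows "mon_eval x m = (\<Prod>v\<in>A. x v ^ Poly_Mapping.lookup m v)"
  unfolding mon_eval_def
  using assms by (intro prod.mono_neutral_left) (auto simp: in_keys_iff)

lemma mon_eval_add: "mon_eval x (m + m') = mon_eval x m * mon_eval x m'"
proof -
  let ?A = "Poly_Mapping.keys m \<union> Poly_Mapping.keys m'"
  have "Poly_Mapping.keys (m + m') \<subseteq> ?A"
    by (rule Poly_Mapping.keys_add)
  then show ?thesis
    by (simp add: mon_eval_superset[of ?A] lookup_add power_add prod.distrib)
qed

lemma mpol_sum_monomials:
  "p = (\<Sum>m\<in>Poly_Mapping.keys p. Poly_Mapping.single m (Poly_Mapping.lookup p m))"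
  by (rule poly_mapping_eqI)
     (auto simp: lookup_sum lookup_single when_def in_keys_iff sum.delta)

lemma mpol_eval_mult: "mpol_eval x (p * q) = mpol_eval x p * mpol_eval x q"
proof -
  have "p * q = (\<Sum>a\<in>Poly_Mapping.keys p. \<Sum>b\<in>Poly_Mapping.keys q.
      Poly_Mapping.single (a + b) (Poly_Mapping.lookup p a * Poly_Mapping.lookup q b))"
    by (subst mpol_sum_monomials[of p], subst mpol_sum_monomials[of q])
       (simp add: sum_product mult_single)
  also have "mpol_eval x \<dots> = mpol_eval x p * mpol_eval x q"
    unfolding mpol_eval_sum mpol_eval_single mon_eval_add
    by (simp add: mpol_eval_def sum_product mult_ac)
  finally show ?thesis .
qed

lemma mpol_vars_mult: "mpol_vars (p * q) \<subseteq> mpol_vars p \<union> mpol_vars q"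
proof
  fix v assume "v \<in> mpol_vars (p * q)"
  then obtain m where m: "m \<in> Poly_Mapping.keys (p * q)" "v \<in> Poly_Mapping.keys m"
    by (auto simp: mpol_vars_def)
  then obtain a b where "m = a + b" "a \<in> Poly_Mapping.keys p" "b \<in> Poly_Mapping.keys q"
    using Poly_Mapping.keys_mult[of p q] by blast
  then show "v \<in> mpol_vars p \<union> mpol_vars q"
    using m(2) Poly_Mapping.keys_add[of a b] by (auto simp: mpol_vars_def)
qed

lemma istopology_zariski:
  "istopology (\<lambda>U. \<exists>S\<subseteq>coord_polys n d. U = Omega n d - zero_locus n d S)"
  unfolding istopology_def
proof (intro conjI allI impI)
  fix U V
  assume "\<exists>S\<subseteq>coord_polys n d. U = Omega n d - zero_locus n d S"
    and "\<exists>S\<subseteq>coord_polys n d. V = Omega n d - zero_locus n d S"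
  then obtain S S' where S: "S \<subseteq> coord_polys n d" "U = Omega n d - zero_locus n d S"
    and S': "S' \<subseteq> coord_polys n d" "V = Omega n d - zero_locus n d S'"
    by blast
  let ?R = "{P * Q | P Q. P \<in> S \<and> Q \<in> S'}"
  have "?R \<subseteq> coord_polys n d"
    using S(1) S'(1) mpol_vars_mult by (fastforce simp: coord_polys_def)
  moreover have "U \<inter> V = Omega n d - zero_locus n d ?R"
    unfolding S(2) S'(2) zero_locus_def by (fastforce simp: mpol_eval_mult)
  ultimately show "\<exists>R\<subseteq>coord_polys n d. U \<inter> V = Omega n d - zero_locus n d R"
    by blast
next
  fix \<K>
  assume "\<forall>U\<in>\<K>. \<exists>S\<subseteq>coord_polys n d. U = Omega n d - zero_locus n d S"
  then obtain s where s: "\<And>U. U \<in> \<K> \<Longrightarrow> s U \<subseteq> coord_polys n d"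
      "\<And>U. U \<in> \<K> \<Longrightarrow> U = Omega n d - zero_locus n d (s U)"
    by metis
  have "\<Union>\<K> = (\<Union>U\<in>\<K>. Omega n d - zero_locus n d (s U))"
    using s(2) by auto
  also have "\<dots> = Omega n d - zero_locus n d (\<Union>U\<in>\<K>. s U)"
    by (auto simp: zero_locus_def)
  finally show "\<exists>S\<subseteq>coord_polys n d. \<Union>\<K> = Omega n d - zero_locus n d S"
    using s(1) by (intro exI[of _ "\<Union>U\<in>\<K>. s U"]) auto
qed

lemma openin_zariski:
  "openin (zariski n d) U \<longleftrightarrow> (\<exists>S\<subseteq>coord_polys n d. U = Omega n d - zero_locus n d S)"
  unfolding zariski_def topology_inverse'[OF istopology_zariski] ..

lemma topspace_zariski [simp]: "topspace (zariski n d) = Omega n d"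
proof
  show "topspace (zariski n d) \<subseteq> Omega n d"
    using openin_topspace[of "zariski n d"] unfolding openin_zariski by auto
  have "Omega n d = Omega n d - zero_locus n d {1}"
    by (auto simp: zero_locus_def)
  moreover have "{1} \<subseteq> coord_polys n d"
    by (simp add: coord_polys_def mpol_vars_def)
  ultimately have "openin (zariski n d) (Omega n d)"
    unfolding openin_zariski by blast
  then show "Omega n d \<subseteq> topspace (zariski n d)"
    by (rule openin_subset)
qed

lemma closedin_zariski:
  "closedin (zariski n d) C \<longleftrightarrow> (\<exists>S\<subseteq>coord_polys n d. C = zero_locus n d S)"
proof -
  have "zero_locus n d S \<subseteq> Omega n d" for S
    by (auto simp: zero_locus_def)
  then show ?thesis
    unfolding closedin_def topspace_zariski openin_zariski
    by (metis double_diff subset_refl Diff_subset)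
qed

end

theory Submission
  imports Defs "HOL-Library.Product_Lexorder"
begin

text \<open>Dichotomy: the automorphisms are closed in \<open>Keller n d\<close>. If \<open>F\<close> has an inverse \<open>G\<close>, counting
  monomials gives a relation \<open>P(x\<^sub>i, F) = 0\<close> whose degree depends only on \<open>n\<close> and \<open>d\<close>, and
  substituting \<open>x = G(y)\<close> bounds the degree of \<open>G\<close> by some \<open>D\<close>. Since the components of a Keller map
  are algebraically independent, \<open>F\<close> is an automorphism iff every \<open>x\<^sub>i\<close> is linearly dependent on the
  products of components of degree at most \<open>D\<close>, a determinantal condition on the coefficients.

  Dimension: the shears \<open>F\<^sub>i \<mapsto> F\<^sub>i + t F\<^sub>j\<close> and the translations \<open>F\<^sub>i \<mapsto> F\<^sub>i + t\<close> map an irreducible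
  component to itself, because the union over \<open>t\<close> of the images of an irreducible set is again
  irreducible. Applying these \<open>n\<^sup>2\<close> one-parameter families to a point one after the other, in a
  suitable order, gives a chain of \<open>n\<^sup>2 + 1\<close> irreducible sets with strictly increasing closures.\<close>

section \<open>Multivariate polynomials\<close>

text \<open>The degree bound for inverses has to be uniform in \<open>F\<close>: with bounds
  depending on \<open>F\<close> the automorphisms would only be an increasing union of closed sets.
  The bound obtained is far from the sharp \<open>d ^ (n - 1)\<close>, but it costs only linear
  algebra and a comparison of degrees. Linear dependence is tested by evaluating at arbitrary
  points; the resulting determinants are visibly polynomial in the coefficients of \<open>F\<close>.
  Shears and translations generate the special linear group and the translations, acting by F
  \<mapsto> A \<circ> F. They are used one family at a time because each family is polynomial in
  \<open>t\<close>: a line cannot be covered by two closed sets unless one of them contains it.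
  There are n(n-1) linear shears and n translations. No orbit dimension is computed. Each step of
  the chain is certified strict by one entry of A that vanishes up to that step, and arranging this
  is the purpose of the order.\<close>

definition mvar :: "'v \<Rightarrow> ('v, 'a::zero_neq_one) mpol" where
  "mvar v = Poly_Mapping.single (Poly_Mapping.single v 1) 1"

abbreviation mconst :: "'a::zero \<Rightarrow> ('v, 'a) mpol" where
  "mconst c \<equiv> Poly_Mapping.single 0 c"

lemma mon_eval_0 [simp]: "mon_eval x 0 = 1"
  by (simp add: mon_eval_def)

lemma mon_eval_single [simp]: "mon_eval x (Poly_Mapping.single v k) = x v ^ k"
  by (cases "k = 0") (auto simp: mon_eval_def)

lemma mpol_eval_mvar [simp]: "mpol_eval x (mvar v) = x v"
  by (simp add: mvar_def mpol_eval_single)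

lemma mpol_eval_mconst [simp]: "mpol_eval x (mconst c) = c"
  by (simp add: mpol_eval_single)

lemma comm_ring_hom_mpol_eval:
  "comm_ring_hom (mpol_eval x :: ('v, 'a::comm_ring_1) mpol \<Rightarrow> 'a)"
  by unfold_locales (auto simp: mpol_eval_add mpol_eval_mult)

lemma mpol_eval_prod: "mpol_eval x (prod f A) = (\<Prod>a\<in>A. mpol_eval x (f a))"
  by (induction A rule: infinite_finite_induct) (auto simp: mpol_eval_mult)

lemma mpol_eval_power: "mpol_eval x (p ^ k) = mpol_eval x p ^ k"
  by (induction k) (auto simp: mpol_eval_mult)

lemma mpol_eval_mon_eval: "mpol_eval x (mon_eval f m) = mon_eval (\<lambda>v. mpol_eval x (f v)) m"
  by (simp add: mon_eval_def mpol_eval_prod mpol_eval_power)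

lemma mon_eval_cong:
  "(\<And>v. v \<in> Poly_Mapping.keys m \<Longrightarrow> x v = y v) \<Longrightarrow> mon_eval x m = mon_eval y m"
  by (simp add: mon_eval_def)

lemma mpol_eval_cong:
  assumes "\<And>v. v \<in> mpol_vars p \<Longrightarrow> x v = y v"
  shows "mpol_eval x p = mpol_eval y p"
  unfolding mpol_eval_def
  by (intro sum.cong refl arg_cong2[of _ _ _ _ "(*)"] mon_eval_cong assms)
     (auto simp: mpol_vars_def)

lemma mpol_vars_0 [simp]: "mpol_vars 0 = {}"
  by (simp add: mpol_vars_def)

lemma mpol_vars_mconst [simp]: "mpol_vars (mconst c) = {}"
  by (simp add: mpol_vars_def)

lemma mpol_vars_1 [simp]: "mpol_vars 1 = {}"
  by (simp add: mpol_vars_def)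

lemma mpol_vars_mvar [simp]: "mpol_vars (mvar v :: ('v, 'a::zero_neq_one) mpol) = {v}"
  by (simp add: mvar_def mpol_vars_def)

lemma mpol_vars_single: "mpol_vars (Poly_Mapping.single m c) \<subseteq> Poly_Mapping.keys m"
  by (simp add: mpol_vars_def)

lemma mpol_vars_add: "mpol_vars (p + q) \<subseteq> mpol_vars p \<union> mpol_vars q"
  using Poly_Mapping.keys_add[of p q] by (auto simp: mpol_vars_def)

lemma mpol_vars_sum: "(\<And>a. a \<in> A \<Longrightarrow> mpol_vars (f a) \<subseteq> V) \<Longrightarrow> mpol_vars (sum f A) \<subseteq> V"
proof (induction A rule: infinite_finite_induct)
  case (insert a A)
  then show ?case using mpol_vars_add[of "f a" "sum f A"] by auto
qed auto

lemma mpol_vars_prod: "(\<And>a. a \<in> A \<Longrightarrow> mpol_vars (f a) \<subseteq> V) \<Longrightarrow> mpol_vars (prod f A) \<subseteq> V"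
proof (induction A rule: infinite_finite_induct)
  case (insert a A)
  then show ?case using mpol_vars_mult[of "f a" "prod f A"] by auto
qed auto

lemma mpol_vars_power: "mpol_vars p \<subseteq> V \<Longrightarrow> mpol_vars (p ^ k) \<subseteq> V"
proof (induction k)
  case (Suc k)
  then show ?case using mpol_vars_mult[of p "p ^ k"] by auto
qed auto

lemma mpol_vars_mon_eval:
  "(\<And>v. v \<in> Poly_Mapping.keys m \<Longrightarrow> mpol_vars (f v) \<subseteq> V) \<Longrightarrow> mpol_vars (mon_eval f m) \<subseteq> V"
  unfolding mon_eval_def by (intro mpol_vars_prod mpol_vars_power) auto

subsection \<open>Total degree\<close>

lemma mon_deg_superset:
  assumes "finite A" "Poly_Mapping.keys m \<subseteq> A"
  shows "mon_deg m = (\<Sum>v\<in>A. Poly_Mapping.lookup m v)"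
  unfolding mon_deg_def using assms by (intro sum.mono_neutral_left) (auto simp: in_keys_iff)

lemma mon_deg_add: "mon_deg (a + b) = mon_deg a + mon_deg b"
proof -
  let ?A = "Poly_Mapping.keys a \<union> Poly_Mapping.keys b"
  have "Poly_Mapping.keys (a + b) \<subseteq> ?A"
    by (rule Poly_Mapping.keys_add)
  then show ?thesis
    by (simp add: mon_deg_superset[of ?A] lookup_add sum.distrib)
qed

lemma mon_deg_0 [simp]: "mon_deg 0 = 0"
  by (simp add: mon_deg_def)

lemma mon_deg_single [simp]: "mon_deg (Poly_Mapping.single v k) = k"
  by (cases "k = 0") (auto simp: mon_deg_def)

lemma total_deg_le_iff: "total_deg p \<le> e \<longleftrightarrow> (\<forall>m\<in>Poly_Mapping.keys p. mon_deg m \<le> e)"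
  by (auto simp: total_deg_def)

lemma mon_deg_le_total_deg: "m \<in> Poly_Mapping.keys p \<Longrightarrow> mon_deg m \<le> total_deg p"
  using total_deg_le_iff by blast

lemma total_deg_0 [simp]: "total_deg 0 = 0"
  by (simp add: total_deg_def)

lemma total_deg_mconst [simp]: "total_deg (mconst c) = 0"
  by (simp add: total_deg_def)

lemma total_deg_1 [simp]: "total_deg 1 = 0"
  by (simp add: total_deg_def)

lemma total_deg_single_le: "total_deg (Poly_Mapping.single m c) \<le> mon_deg m"
  by (simp add: total_deg_def)

lemma total_deg_mvar_le: "total_deg (mvar v) \<le> 1"
  using total_deg_single_le[of "Poly_Mapping.single v 1" 1] by (simp add: mvar_def)

lemma total_deg_add_le: "total_deg p \<le> e \<Longrightarrow> total_deg q \<le> e \<Longrightarrow> total_deg (p + q) \<le> e"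
  using Poly_Mapping.keys_add[of p q] unfolding total_deg_le_iff by blast

lemma total_deg_sum_le: "(\<And>a. a \<in> A \<Longrightarrow> total_deg (f a) \<le> e) \<Longrightarrow> total_deg (sum f A) \<le> e"
  by (induction A rule: infinite_finite_induct) (auto intro: total_deg_add_le)

lemma total_deg_mult_le: "total_deg (p * q) \<le> total_deg p + total_deg q"
proof -
  have "mon_deg m \<le> total_deg p + total_deg q" if "m \<in> Poly_Mapping.keys (p * q)" for m
  proof -
    from that obtain a b where "m = a + b" "a \<in> Poly_Mapping.keys p" "b \<in> Poly_Mapping.keys q"
      using Poly_Mapping.keys_mult[of p q] by blast
    then show ?thesis
      by (simp add: mon_deg_add add_mono mon_deg_le_total_deg)
  qed
  then show ?thesis by (simp add: total_deg_le_iff)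
qed

lemma total_deg_power_le: "total_deg (p ^ k) \<le> k * total_deg p"
proof (induction k)
  case (Suc k)
  then show ?case using total_deg_mult_le[of p "p ^ k"] by simp
qed auto

lemma total_deg_prod_le: "total_deg (prod f A) \<le> (\<Sum>a\<in>A. total_deg (f a))"
proof (induction A rule: infinite_finite_induct)
  case (insert a A)
  then show ?case using total_deg_mult_le[of "f a" "prod f A"] by simp
qed auto

lemma total_deg_mon_eval_le:
  assumes "\<And>v. v \<in> Poly_Mapping.keys m \<Longrightarrow> total_deg (f v) \<le> d"
  shows "total_deg (mon_eval f m) \<le> mon_deg m * d"
proof -
  have "total_deg (mon_eval f m)
      \<le> (\<Sum>v\<in>Poly_Mapping.keys m. total_deg (f v ^ Poly_Mapping.lookup m v))"
    unfolding mon_eval_def by (rule total_deg_prod_le)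
  also have "\<dots> \<le> (\<Sum>v\<in>Poly_Mapping.keys m. Poly_Mapping.lookup m v * d)"
    by (intro sum_mono order.trans[OF total_deg_power_le] mult_left_mono assms) auto
  finally show ?thesis by (simp add: mon_deg_def sum_distrib_right)
qed

text \<open>Marking each monomial by its degree in a new variable turns the total degree into the degree
  of a univariate polynomial over an integral domain, where degrees of products add up.\<close>

definition graded :: "('v, 'a::comm_ring_1) mpol \<Rightarrow> ('v, 'a) mpol poly" where
  "graded p = (\<Sum>m\<in>Poly_Mapping.keys p.
     monom (Poly_Mapping.single m (Poly_Mapping.lookup p m)) (mon_deg m))"

lemma graded_superset:
  assumes "finite A" "Poly_Mapping.keys p \<subseteq> A"
  shows "graded p = (\<Sum>m\<in>A. monom (Poly_Mapping.single m (Poly_Mapping.lookup p m)) (mon_deg m))"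
  unfolding graded_def
  using assms by (intro sum.mono_neutral_left) (auto simp: in_keys_iff)

lemma graded_0 [simp]: "graded 0 = 0"
  by (simp add: graded_def)

lemma graded_add: "graded (p + q) = graded p + graded q"
proof -
  let ?A = "Poly_Mapping.keys p \<union> Poly_Mapping.keys q"
  have "Poly_Mapping.keys (p + q) \<subseteq> ?A"
    by (rule Poly_Mapping.keys_add)
  then show ?thesis
    by (simp add: graded_superset[of ?A] lookup_add single_add add_monom[symmetric] sum.distrib)
qed

lemma graded_sum: "graded (sum f A) = (\<Sum>a\<in>A. graded (f a))"
  by (induction A rule: infinite_finite_induct) (auto simp: graded_add)

lemma graded_single: "graded (Poly_Mapping.single m c) = monom (Poly_Mapping.single m c) (mon_deg m)"
  by (cases "c = 0") (auto simp: graded_def)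

lemma graded_mult: "graded (p * q) = graded p * graded q"
proof -
  have "p * q = (\<Sum>a\<in>Poly_Mapping.keys p. \<Sum>b\<in>Poly_Mapping.keys q.
      Poly_Mapping.single (a + b) (Poly_Mapping.lookup p a * Poly_Mapping.lookup q b))"
    by (subst mpol_sum_monomials[of p], subst mpol_sum_monomials[of q])
       (simp add: sum_product mult_single)
  also have "graded \<dots> = graded p * graded q"
    unfolding graded_sum graded_single
    by (simp add: graded_def sum_product mult_monom mult_single mon_deg_add)
  finally show ?thesis .
qed

lemma lookup_coeff_graded:
  "Poly_Mapping.lookup (coeff (graded p) e) m = (if mon_deg m = e then Poly_Mapping.lookup p m else 0)"
proof -
  have "Poly_Mapping.lookup (coeff (graded p) e) m =
     (\<Sum>k\<in>Poly_Mapping.keys p. if k = m then (if mon_deg m = e then Poly_Mapping.lookup p m else 0) else 0)"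
    unfolding graded_def coeff_sum lookup_sum coeff_monom
    by (intro sum.cong) (auto simp: lookup_single when_def)
  also have "\<dots> = (if mon_deg m = e then Poly_Mapping.lookup p m else 0)"
    by (auto simp: in_keys_iff)
  finally show ?thesis .
qed

lemma degree_graded: "degree (graded p) = total_deg p"
proof (rule antisym)
  show "degree (graded p) \<le> total_deg p"
  proof (rule degree_le, intro allI impI)
    fix e assume e: "total_deg p < e"
    show "coeff (graded p) e = 0"
      using e mon_deg_le_total_deg[of _ p]
      by (intro poly_mapping_eqI) (force simp: lookup_coeff_graded in_keys_iff)
  qed
  show "total_deg p \<le> degree (graded p)"
    unfolding total_deg_le_iff
  proof
    fix m assume "m \<in> Poly_Mapping.keys p"
    then have "Poly_Mapping.lookup (coeff (graded p) (mon_deg m)) m \<noteq> 0"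
      by (simp add: lookup_coeff_graded in_keys_iff)
    then have "coeff (graded p) (mon_deg m) \<noteq> 0" by auto
    then show "mon_deg m \<le> degree (graded p)" by (rule le_degree)
  qed
qed

lemma graded_eq_0_iff [simp]: "graded p = 0 \<longleftrightarrow> p = 0"
proof
  assume *: "graded p = 0"
  show "p = 0"
  proof (rule poly_mapping_eqI)
    fix m show "Poly_Mapping.lookup p m = Poly_Mapping.lookup 0 m"
      using lookup_coeff_graded[of p "mon_deg m" m] * by simp
  qed
qed simp

text \<open>The linear order on the variables induces one on the monomials; this supplies the
  absence of zero divisors in the coefficient ring of \<open>graded\<close>.\<close>

lemma total_deg_mult:
  fixes p q :: "('v::linorder, 'a::idom) mpol"
  assumes "p \<noteq> 0" "q \<noteq> 0"
  shows "total_deg (p * q) = total_deg p + total_deg q"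
  using assms by (simp flip: degree_graded add: graded_mult degree_mult_eq)

lemma total_deg_power:
  fixes p :: "('v::linorder, 'a::idom) mpol"
  assumes "p \<noteq> 0"
  shows "total_deg (p ^ k) = k * total_deg p"
  using assms by (induction k) (auto simp: total_deg_mult)

subsection \<open>Partial derivatives\<close>

text \<open>Working coefficient by coefficient, the algebraic rules and the bounds on support and
  degree below follow without handling the defining sum.\<close>

lemma lookup_mpol_pderiv:
  "Poly_Mapping.lookup (mpol_pderiv v p) m =
     of_nat (Suc (Poly_Mapping.lookup m v)) * Poly_Mapping.lookup p (m + Poly_Mapping.single v 1)"
proof -
  let ?s = "Poly_Mapping.single v (1::nat)"
  have *: "(Poly_Mapping.lookup (Poly_Mapping.single (k - ?s)
        (of_nat (Poly_Mapping.lookup k v) * Poly_Mapping.lookup p k)) m) =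
      (if k = m + ?s then of_nat (Suc (Poly_Mapping.lookup m v)) * Poly_Mapping.lookup p k else 0)" for k
  proof (cases "Poly_Mapping.lookup k v = 0")
    case True
    then have "k \<noteq> m + ?s" by (auto simp: lookup_add)
    with True show ?thesis by (simp add: lookup_single)
  next
    case False
    then have "k - ?s + ?s = k"
      by (intro poly_mapping_eqI) (auto simp: lookup_add lookup_minus lookup_single when_def)
    then have "k - ?s = m \<longleftrightarrow> k = m + ?s" by auto
    then show ?thesis by (auto simp: lookup_single when_def lookup_add)
  qed
  show ?thesis
    unfolding mpol_pderiv_def lookup_sum * by (auto simp: in_keys_iff)
qed

lemma mpol_pderiv_add: "mpol_pderiv v (p + q) = mpol_pderiv v p + mpol_pderiv v q"
  by (rule poly_mapping_eqI) (simp add: lookup_mpol_pderiv lookup_add algebra_simps)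

lemma lookup_mconst_mult: "Poly_Mapping.lookup (mconst c * p) m = c * Poly_Mapping.lookup p m"
proof -
  have "mconst c * p = (\<Sum>k\<in>Poly_Mapping.keys p. Poly_Mapping.single k (c * Poly_Mapping.lookup p k))"
    by (subst mpol_sum_monomials[of p]) (simp add: sum_distrib_left mult_single)
  then show ?thesis
    by (auto simp: lookup_sum lookup_single when_def in_keys_iff)
qed

lemma mpol_pderiv_mconst_mult: "mpol_pderiv v (mconst c * p) = mconst c * mpol_pderiv v p"
  by (rule poly_mapping_eqI) (simp add: lookup_mpol_pderiv lookup_mconst_mult mult.left_commute del: of_nat_Suc)

lemma mpol_pderiv_mconst [simp]: "mpol_pderiv v (mconst c) = 0"
  by (simp add: mpol_pderiv_def lookup_single when_def)

lemma mpol_pderiv_1 [simp]: "mpol_pderiv v 1 = 0"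
  by (simp add: mpol_pderiv_def)

lemma mpol_pderiv_mvar: "mpol_pderiv j (mvar i) = (if i = j then 1 else 0)"
  by (auto simp: mvar_def mpol_pderiv_def lookup_single when_def)

lemma keys_mpol_pderiv:
  assumes "m \<in> Poly_Mapping.keys (mpol_pderiv v p)"
  shows "m + Poly_Mapping.single v 1 \<in> Poly_Mapping.keys p"
  using assms by (auto simp: in_keys_iff lookup_mpol_pderiv)

lemma mpol_vars_pderiv: "mpol_vars (mpol_pderiv v p) \<subseteq> mpol_vars p"
proof
  fix u assume "u \<in> mpol_vars (mpol_pderiv v p)"
  then obtain m where m: "m \<in> Poly_Mapping.keys (mpol_pderiv v p)" "u \<in> Poly_Mapping.keys m"
    by (auto simp: mpol_vars_def)
  from m(2) have "u \<in> Poly_Mapping.keys (m + Poly_Mapping.single v 1)"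
    by (auto simp: in_keys_iff lookup_add)
  with keys_mpol_pderiv[OF m(1)] show "u \<in> mpol_vars p" by (auto simp: mpol_vars_def)
qed

lemma total_deg_pderiv_le:
  assumes "total_deg p \<le> Suc e"
  shows "total_deg (mpol_pderiv v p) \<le> e"
  unfolding total_deg_le_iff
proof
  fix m assume "m \<in> Poly_Mapping.keys (mpol_pderiv v p)"
  from mon_deg_le_total_deg[OF keys_mpol_pderiv[OF this]] assms
  show "mon_deg m \<le> e" by (simp add: mon_deg_add)
qed

lemma mpol_eval_pderiv:
  "mpol_eval x (mpol_pderiv v p) = (\<Sum>m\<in>Poly_Mapping.keys p.
     Poly_Mapping.lookup p m * (of_nat (Poly_Mapping.lookup m v) * mon_eval x (m - Poly_Mapping.single v 1)))"
  by (simp add: mpol_pderiv_def mpol_eval_sum mpol_eval_single mult_ac)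

lemma has_field_derivative_mon_eval:
  fixes f :: "'v \<Rightarrow> 'a::real_normed_field \<Rightarrow> 'a"
  assumes "finite V" "Poly_Mapping.keys m \<subseteq> V"
    and "\<And>v. v \<in> V \<Longrightarrow> (f v has_field_derivative f' v) (at t)"
  shows "((\<lambda>s. mon_eval (\<lambda>v. f v s) m) has_field_derivative
    (\<Sum>v\<in>V. f' v * (of_nat (Poly_Mapping.lookup m v) *
       mon_eval (\<lambda>v. f v t) (m - Poly_Mapping.single v 1)))) (at t)"
proof -
  have k: "Poly_Mapping.keys (m - Poly_Mapping.single v 1) \<subseteq> V" for v
    using assms(2) by (auto simp: in_keys_iff lookup_minus)
  have "((\<lambda>s. \<Prod>v\<in>V. f v s ^ Poly_Mapping.lookup m v) has_field_derivative
      (\<Sum>v\<in>V. (of_nat (Poly_Mapping.lookup m v) * (f' v * f v t ^ (Poly_Mapping.lookup m v - Suc 0)))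
         * (\<Prod>u\<in>V - {v}. f u t ^ Poly_Mapping.lookup m u))) (at t)"
    by (intro has_field_derivative_prod DERIV_power assms)
  also have "(\<Sum>v\<in>V. (of_nat (Poly_Mapping.lookup m v) * (f' v * f v t ^ (Poly_Mapping.lookup m v - Suc 0)))
         * (\<Prod>u\<in>V - {v}. f u t ^ Poly_Mapping.lookup m u)) =
      (\<Sum>v\<in>V. f' v * (of_nat (Poly_Mapping.lookup m v) *
       mon_eval (\<lambda>v. f v t) (m - Poly_Mapping.single v 1)))"
  proof (rule sum.cong[OF refl])
    fix v assume v: "v \<in> V"
    have "mon_eval (\<lambda>v. f v t) (m - Poly_Mapping.single v 1) =
        f v t ^ (Poly_Mapping.lookup m v - Suc 0) * (\<Prod>u\<in>V - {v}. f u t ^ Poly_Mapping.lookup m u)"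
      unfolding mon_eval_superset[OF assms(1) k] prod.remove[OF assms(1) v]
      by (intro arg_cong2[of _ _ _ _ "(*)"] prod.cong)
         (auto simp: lookup_minus lookup_single when_def)
    then show "(of_nat (Poly_Mapping.lookup m v) * (f' v * f v t ^ (Poly_Mapping.lookup m v - Suc 0)))
         * (\<Prod>u\<in>V - {v}. f u t ^ Poly_Mapping.lookup m u) = f' v * (of_nat (Poly_Mapping.lookup m v) *
       mon_eval (\<lambda>v. f v t) (m - Poly_Mapping.single v 1))" by (simp add: mult_ac)
  qed
  finally show ?thesis
    unfolding mon_eval_superset[OF assms(1,2)] .
qed

text \<open>Chain rule along an arbitrary curve. Relations between polynomials are used as functions
  that vanish everywhere, so pointwise derivatives stand in for a formal chain rule.\<close>

lemma has_field_derivative_mpol_eval: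
  fixes f :: "'v \<Rightarrow> 'a::real_normed_field \<Rightarrow> 'a"
  assumes "finite V" "mpol_vars p \<subseteq> V"
    and "\<And>v. v \<in> V \<Longrightarrow> (f v has_field_derivative f' v) (at t)"
  shows "((\<lambda>s. mpol_eval (\<lambda>v. f v s) p) has_field_derivative
    (\<Sum>v\<in>V. f' v * mpol_eval (\<lambda>v. f v t) (mpol_pderiv v p))) (at t)"
proof -
  have "((\<lambda>s. \<Sum>m\<in>Poly_Mapping.keys p. Poly_Mapping.lookup p m * mon_eval (\<lambda>v. f v s) m)
    has_field_derivative (\<Sum>m\<in>Poly_Mapping.keys p. Poly_Mapping.lookup p m *
      (\<Sum>v\<in>V. f' v * (of_nat (Poly_Mapping.lookup m v) *
       mon_eval (\<lambda>v. f v t) (m - Poly_Mapping.single v 1))))) (at t)"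
    using assms
    by (intro DERIV_sum DERIV_cmult has_field_derivative_mon_eval) (auto simp: mpol_vars_def)
  also have "(\<Sum>m\<in>Poly_Mapping.keys p. Poly_Mapping.lookup p m *
      (\<Sum>v\<in>V. f' v * (of_nat (Poly_Mapping.lookup m v) *
       mon_eval (\<lambda>v. f v t) (m - Poly_Mapping.single v 1)))) =
     (\<Sum>v\<in>V. f' v * mpol_eval (\<lambda>v. f v t) (mpol_pderiv v p))"
    unfolding mpol_eval_pderiv sum_distrib_left
    by (subst sum.swap) (simp add: mult_ac)
  finally show ?thesis unfolding mpol_eval_def .
qed

section \<open>Algebraic independence of the components of a Keller map\<close>

lemma mpol_eq_mconst:
  assumes "Poly_Mapping.keys p \<subseteq> {0}"
  shows "p = mconst (Poly_Mapping.lookup p 0)"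
proof (rule poly_mapping_eqI)
  fix m show "Poly_Mapping.lookup p m = Poly_Mapping.lookup (mconst (Poly_Mapping.lookup p 0)) m"
    using assms by (cases "m = 0") (auto simp: lookup_single in_keys_iff)
qed

lemma mon_deg_eq_0_iff [simp]: "mon_deg m = 0 \<longleftrightarrow> m = 0"
  by (auto simp: mon_deg_def in_keys_iff intro!: poly_mapping_eqI)

text \<open>Characteristic 0: the coefficient of a monomial containing \<open>v\<close> reappears in
  the derivative by \<open>v\<close>, multiplied by a positive exponent.\<close>

lemma pderivs_0_imp_mconst:
  fixes p :: "('v, 'a::{idom, ring_char_0}) mpol"
  assumes "\<And>v. v \<in> mpol_vars p \<Longrightarrow> mpol_pderiv v p = 0"
  shows "p = mconst (Poly_Mapping.lookup p 0)"
proof (rule mpol_eq_mconst, rule subsetI)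
  fix m assume m: "m \<in> Poly_Mapping.keys p"
  show "m \<in> {0}"
  proof (rule ccontr)
    assume "m \<notin> {0}"
    then have "Poly_Mapping.keys m \<noteq> {}" by simp
    then obtain v where v: "v \<in> Poly_Mapping.keys m" by blast
    define k where "k = m - Poly_Mapping.single v 1"
    have "k + Poly_Mapping.single v 1 = m"
      using v unfolding k_def
      by (intro poly_mapping_eqI) (auto simp: lookup_add lookup_minus lookup_single when_def in_keys_iff)
    moreover have "mpol_pderiv v p = 0"
      using assms m v by (auto simp: mpol_vars_def)
    then have "Poly_Mapping.lookup (mpol_pderiv v p) k = 0" by simp
    ultimately have "Poly_Mapping.lookup p m = 0"
      by (simp add: lookup_mpol_pderiv del: of_nat_Suc)
    with m show False by (simp add: in_keys_iff)
  qed
qed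

lemma polymapsD:
  assumes "F \<in> polymaps n"
  shows "dim_vec F = n" "F \<in> carrier_vec n" "i < n \<Longrightarrow> mpol_vars (F $ i) \<subseteq> {..<n}"
  using assms by (auto simp: polymaps_def)

lemma has_field_derivative_along_axis:
  fixes p :: "(nat, complex) mpol"
  assumes "mpol_vars p \<subseteq> {..<n}" "k < n"
  shows "((\<lambda>s. mpol_eval (x(k := x k + s)) p) has_field_derivative mpol_eval x (mpol_pderiv k p)) (at 0)"
proof -
  have "((\<lambda>s. mpol_eval (\<lambda>v. (x(k := x k + s)) v) p) has_field_derivative
    (\<Sum>v<n. (if v = k then 1 else 0) * mpol_eval (\<lambda>v. (x(k := x k + 0)) v) (mpol_pderiv v p))) (at 0)"
    by (rule has_field_derivative_mpol_eval) (use assms in \<open>auto intro!: derivative_eq_intros\<close>)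
  also have "(\<Sum>v<n. (if v = k then 1 else 0) * mpol_eval (\<lambda>v. (x(k := x k + 0)) v) (mpol_pderiv v p))
      = mpol_eval x (mpol_pderiv k p)"
    using assms(2) by (simp add: if_distrib[of "\<lambda>c. c * _"] cong: if_cong)
  finally show ?thesis by (simp add: fun_upd_def)
qed

lemma det_mpol_eval_pderiv:
  assumes "dim_vec F = n" "Jac F = 1"
  shows "det (mat n n (\<lambda>(i, j). mpol_eval x (mpol_pderiv j (F $ i)))) = 1"
proof -
  interpret comm_ring_hom "mpol_eval x :: (nat, complex) mpol \<Rightarrow> complex"
    by (rule comm_ring_hom_mpol_eval)
  have "mat n n (\<lambda>(i, j). mpol_eval x (mpol_pderiv j (F $ i)))
     = map_mat (mpol_eval x) (mat n n (\<lambda>(i, j). mpol_pderiv j (F $ i)))"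
    by (rule eq_matI) auto
  then show ?thesis
    using assms by (simp add: Jac_def)
qed

text \<open>Differentiating a relation \<open>P(F) = 0\<close> and cancelling the invertible Jacobian matrix gives the
  relations \<open>(\<partial>\<^sub>v P)(F) = 0\<close> of smaller degree.\<close>

lemma Jac_1_imp_alg_independent:
  assumes F: "F \<in> polymaps n" "Jac F = 1"
    and "mpol_vars P \<subseteq> {..<n}" "\<And>x. mpol_eval (\<lambda>j. mpol_eval x (F $ j)) P = 0"
  shows "P = 0"
proof -
  have "P = 0" if "total_deg P \<le> e" "mpol_vars P \<subseteq> {..<n}"
      "\<And>x. mpol_eval (\<lambda>j. mpol_eval x (F $ j)) P = 0" for e P
    using that
  proof (induction e arbitrary: P)
    case 0
    from 0(1) have "Poly_Mapping.keys P \<subseteq> {0}"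
      unfolding total_deg_le_iff by auto
    then have "P = mconst (Poly_Mapping.lookup P 0)"
      by (rule mpol_eq_mconst)
    with 0(3)[of undefined] show ?case
      by (metis mpol_eval_mconst single_zero)
  next
    case (Suc e)
    have "mpol_pderiv v P = 0" if v: "v < n" for v
    proof (rule Suc.IH)
      show "total_deg (mpol_pderiv v P) \<le> e"
        by (rule total_deg_pderiv_le[OF Suc.prems(1)])
      show "mpol_vars (mpol_pderiv v P) \<subseteq> {..<n}"
        by (rule order.trans[OF mpol_vars_pderiv Suc.prems(2)])
      fix x :: "nat \<Rightarrow> complex"
      define w where "w = (\<lambda>v. mpol_eval (\<lambda>j. mpol_eval x (F $ j)) (mpol_pderiv v P))"
      define J where "J = mat n n (\<lambda>(i, j). mpol_eval x (mpol_pderiv j (F $ i)))"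
      have "(\<Sum>v<n. J $$ (v, k) * w v) = 0" if k: "k < n" for k
      proof -
        \<comment> \<open>Only coordinate \<open>k\<close> of the point moves, so component
          \<open>j\<close> of \<open>F\<close> has derivative \<open>J $$ (j, k)\<close>; the chain
          rule yields entry \<open>k\<close> of the transposed Jacobian matrix applied to
          \<open>w\<close>.\<close>
        have "((\<lambda>s. mpol_eval (\<lambda>j. mpol_eval (x(k := x k + s)) (F $ j)) P) has_field_derivative
          (\<Sum>v<n. J $$ (v, k) * mpol_eval (\<lambda>j. mpol_eval (x(k := x k + 0)) (F $ j)) (mpol_pderiv v P))) (at 0)"
          using Suc.prems(2) k polymapsD(3)[OF F(1)]
          by (intro has_field_derivative_mpol_eval)
             (auto simp: J_def intro!: has_field_derivative_along_axis)
        then have "((\<lambda>s. 0) has_field_derivative (\<Sum>v<n. J $$ (v, k) * w v)) (at (0::complex))"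
          by (simp add: Suc.prems(3) w_def)
        then show ?thesis
          by (rule DERIV_unique) simp
      qed
      then have "J\<^sup>T *\<^sub>v vec n w = 0\<^sub>v n"
        by (intro eq_vecI) (auto simp: J_def scalar_prod_def atLeast0LessThan)
      moreover have "det J\<^sup>T \<noteq> 0"
        using det_mpol_eval_pderiv[OF polymapsD(1)[OF F(1)] F(2), of x]
        by (subst det_transpose[of _ n]) (auto simp: J_def)
      ultimately have "vec n w = 0\<^sub>v n"
        using det_0_iff_vec_prod_zero[of "J\<^sup>T" n] vec_carrier[of n w]
        by (metis J_def mat_carrier transpose_carrier_mat)
      then show "mpol_eval (\<lambda>j. mpol_eval x (F $ j)) (mpol_pderiv v P) = 0"
        using v by (auto simp: w_def vec_eq_iff)
    qed
    then have "P = mconst (Poly_Mapping.lookup P 0)"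
      using Suc.prems(2) by (intro pderivs_0_imp_mconst) auto
    with Suc.prems(3)[of undefined] show ?case
      by (metis mpol_eval_mconst single_zero)
  qed
  from this[OF order.refl assms(3,4)] show ?thesis .
qed

lemma finite_mpol_vars [simp]: "finite (mpol_vars p)"
  by (simp add: mpol_vars_def)

text \<open>The identity map has Jacobian 1, so this is algebraic independence of its components,
  with \<open>n\<close> large enough to cover the variables of \<open>P\<close>.\<close>

lemma mpol_eq_0I:
  fixes P :: "(nat, complex) mpol"
  assumes "\<And>x. mpol_eval x P = 0"
  shows "P = 0"
proof -
  obtain n where n: "mpol_vars P \<subseteq> {..<n}"
    using finite_nat_iff_bounded finite_mpol_vars by blast
  define I :: polymap where "I = vec n mvar"
  have "Jac I = det (1\<^sub>m n)"
    unfolding Jac_def I_def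
    by (intro arg_cong[of _ _ det] eq_matI) (auto simp: mpol_pderiv_mvar)
  then have J: "Jac I = 1" by simp
  have I: "I \<in> polymaps n"
    by (auto simp: I_def polymaps_def)
  show ?thesis
  proof (rule Jac_1_imp_alg_independent[OF I J n])
    fix x
    have "mpol_eval (\<lambda>j. mpol_eval x (I $ j)) P = mpol_eval x P"
      using n by (intro mpol_eval_cong) (auto simp: I_def)
    then show "mpol_eval (\<lambda>j. mpol_eval x (I $ j)) P = 0" by (simp add: assms)
  qed
qed

section \<open>A degree bound for inverses\<close>

text \<open>Gaussian elimination by induction on the equations: an equation with a nonzero entry at
  \<open>a0\<close> is solved for that unknown, which costs one equation and one unknown.\<close>

lemma underdetermined_system:
  fixes M :: "'a \<Rightarrow> 'b \<Rightarrow> 'k::field"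
  assumes "finite B" "finite A" "card B < card A"
  shows "\<exists>c. (\<exists>a\<in>A. c a \<noteq> 0) \<and> (\<forall>b\<in>B. (\<Sum>a\<in>A. c a * M a b) = 0)"
  using assms
proof (induction B arbitrary: A M rule: finite_induct)
  case empty
  then obtain a where "a \<in> A" by fastforce
  then show ?case by (intro exI[of _ "\<lambda>_. 1"]) auto
next
  case (insert b B)
  show ?case
  proof (cases "\<forall>a\<in>A. M a b = 0")
    case True
    obtain c where "\<exists>a\<in>A. c a \<noteq> 0" "\<forall>b\<in>B. (\<Sum>a\<in>A. c a * M a b) = 0"
      using insert.IH[of A M] insert.prems insert.hyps by auto
    with True show ?thesis by (intro exI[of _ c]) auto
  next
    case False
    then obtain a0 where a0: "a0 \<in> A" "M a0 b \<noteq> 0" by auto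
    define M' where "M' = (\<lambda>a b'. M a b' - M a b / M a0 b * M a0 b')"
    have "card B < card (A - {a0})"
      using insert.prems insert.hyps a0 by simp
    then obtain c where c: "\<exists>a\<in>A - {a0}. c a \<noteq> 0" "\<forall>b\<in>B. (\<Sum>a\<in>A - {a0}. c a * M' a b) = 0"
      using insert.IH[of "A - {a0}" M'] insert.prems by auto
    \<comment> \<open>The value at \<open>a0\<close> is the one that equation \<open>b\<close>
      forces.\<close>
    define c' where "c' = c(a0 := - (\<Sum>a\<in>A - {a0}. c a * (M a b / M a0 b)))"
    have *: "(\<Sum>a\<in>A. c' a * M a b') = (\<Sum>a\<in>A - {a0}. c a * M' a b')" for b'
    proof -
      have "(\<Sum>a\<in>A. c' a * M a b') = c' a0 * M a0 b' + (\<Sum>a\<in>A - {a0}. c' a * M a b')"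
        using insert.prems a0 by (simp add: sum.remove)
      also have "(\<Sum>a\<in>A - {a0}. c' a * M a b') = (\<Sum>a\<in>A - {a0}. c a * M a b')"
        by (intro sum.cong) (auto simp: c'_def)
      also have "c' a0 * M a0 b' = - (\<Sum>a\<in>A - {a0}. c a * (M a b / M a0 b * M a0 b'))"
        by (simp add: c'_def sum_distrib_right mult.assoc)
      finally show ?thesis
        by (simp add: M'_def right_diff_distrib sum_subtractf)
    qed
    have "(\<Sum>a\<in>A - {a0}. c a * M' a b) = 0"
      using a0 by (simp add: M'_def)
    moreover have "\<exists>a\<in>A. c' a \<noteq> 0"
      using c(1) by (auto simp: c'_def)
    moreover have "\<forall>b'\<in>insert b B. (\<Sum>a\<in>A. c' a * M a b') = 0"
      unfolding * using c(2) \<open>(\<Sum>a\<in>A - {a0}. c a * M' a b) = 0\<close> by blast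
    ultimately show ?thesis by blast
  qed
qed

text \<open>A box of exponents has exactly \<open>B ^ n\<close> elements. The count below needs this
  many products, against a mere upper bound for the number of monomials of bounded degree.\<close>

definition mon_box :: "nat \<Rightarrow> nat \<Rightarrow> (nat \<Rightarrow>\<^sub>0 nat) set" where
  "mon_box n B = {m. Poly_Mapping.keys m \<subseteq> {..<n} \<and> (\<forall>j<n. Poly_Mapping.lookup m j < B)}"

lemma bij_betw_mon_box:
  "bij_betw (\<lambda>m. restrict (Poly_Mapping.lookup m) {..<n}) (mon_box n B) ({..<n} \<rightarrow>\<^sub>E {..<B})"
proof (rule bij_betw_imageI)
  show "inj_on (\<lambda>m. restrict (Poly_Mapping.lookup m) {..<n}) (mon_box n B)"
  proof (rule inj_onI, rule poly_mapping_eqI)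
    fix a b j assume a: "a \<in> mon_box n B" and b: "b \<in> mon_box n B"
      and eq: "restrict (Poly_Mapping.lookup a) {..<n} = restrict (Poly_Mapping.lookup b) {..<n}"
    show "Poly_Mapping.lookup a j = Poly_Mapping.lookup b j"
    proof (cases "j < n")
      case True
      with fun_cong[OF eq, of j] show ?thesis by simp
    next
      case False
      then have "j \<notin> Poly_Mapping.keys a" "j \<notin> Poly_Mapping.keys b"
        using a b by (auto simp: mon_box_def)
      then show ?thesis by (simp add: in_keys_iff)
    qed
  qed
  show "(\<lambda>m. restrict (Poly_Mapping.lookup m) {..<n}) ` mon_box n B = {..<n} \<rightarrow>\<^sub>E {..<B}"
  proof (intro equalityI subsetI)
    fix h assume h: "h \<in> {..<n} \<rightarrow>\<^sub>E {..<B}"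
    define m where "m = Abs_poly_mapping (\<lambda>j. if j < n then h j else (0::nat))"
    have "finite {j. (if j < n then h j else 0) \<noteq> 0}"
      by (rule finite_subset[of _ "{..<n}"]) auto
    then have l: "Poly_Mapping.lookup m = (\<lambda>j. if j < n then h j else 0)"
      by (simp add: m_def Abs_poly_mapping_inverse)
    then have "m \<in> mon_box n B"
      using h by (simp add: mon_box_def in_keys_iff PiE_iff subset_iff)
    moreover have "restrict (Poly_Mapping.lookup m) {..<n} = h"
      using h by (intro ext) (simp add: l PiE_def extensional_def)
    ultimately show "h \<in> (\<lambda>m. restrict (Poly_Mapping.lookup m) {..<n}) ` mon_box n B"
      by (metis imageI)
  qed (auto simp: mon_box_def split: if_splits)
qed

lemma card_mon_box: "card (mon_box n B) = B ^ n"
  using bij_betw_same_card[OF bij_betw_mon_box[of n B]] by (simp add: card_PiE)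

lemma finite_mon_box [simp]: "finite (mon_box n B)"
  using bij_betw_finite[OF bij_betw_mon_box[of n B]] by (simp add: finite_PiE)

definition monomials_le :: "nat \<Rightarrow> nat \<Rightarrow> (nat \<Rightarrow>\<^sub>0 nat) set" where
  "monomials_le n e = {m. Poly_Mapping.keys m \<subseteq> {..<n} \<and> mon_deg m \<le> e}"

lemma lookup_le_mon_deg: "Poly_Mapping.lookup m j \<le> mon_deg m"
proof (cases "j \<in> Poly_Mapping.keys m")
  case True
  then show ?thesis unfolding mon_deg_def by (intro member_le_sum) auto
qed (simp add: in_keys_iff)

lemma monomials_le_subset_mon_box: "monomials_le n e \<subseteq> mon_box n (Suc e)"
  by (auto simp: monomials_le_def mon_box_def less_Suc_eq_le intro: order.trans[OF lookup_le_mon_deg])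

lemma finite_monomials_le [simp]: "finite (monomials_le n e)"
  by (rule finite_subset[OF monomials_le_subset_mon_box finite_mon_box])

lemma card_monomials_le: "card (monomials_le n e) \<le> Suc e ^ n"
  using card_mono[OF finite_mon_box monomials_le_subset_mon_box] by (simp add: card_mon_box)

lemma keys_subset_monomials_le:
  assumes "mpol_vars p \<subseteq> {..<n}" "total_deg p \<le> e"
  shows "Poly_Mapping.keys p \<subseteq> monomials_le n e"
proof
  fix m assume m: "m \<in> Poly_Mapping.keys p"
  then have "Poly_Mapping.keys m \<subseteq> mpol_vars p"
    by (auto simp: mpol_vars_def)
  with m assms show "m \<in> monomials_le n e"
    by (simp add: monomials_le_def total_deg_le_iff)
qed

text \<open>Compare the degree of the top term \<open>C\<^sub>K g\<^sup>K\<close> with that of the remaining terms.\<close>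

lemma total_deg_root_le:
  fixes g :: "('v::linorder, 'a::idom) mpol"
  assumes 0: "(\<Sum>k<B. C k * g ^ k) = 0" and nz: "\<exists>k<B. C k \<noteq> 0"
    and D: "\<And>k. k < B \<Longrightarrow> total_deg (C k) \<le> D"
  shows "total_deg g \<le> D"
proof (rule ccontr)
  assume "\<not> total_deg g \<le> D"
  then have gD: "D < total_deg g" by simp
  then have g0: "g \<noteq> 0" by auto
  define K where "K = Max {k. k < B \<and> C k \<noteq> 0}"
  have "K \<in> {k. k < B \<and> C k \<noteq> 0}"
    unfolding K_def using nz by (intro Max_in) auto
  then have K: "K < B" "C K \<noteq> 0" by auto
  have top: "C k = 0" if "K < k" "k < B" for k
  proof (rule ccontr)
    assume "C k \<noteq> 0"
    with that have "k \<le> K"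
      unfolding K_def by (intro Max_ge) auto
    with that show False by simp
  qed
  have "(\<Sum>k<B. C k * g ^ k) = (\<Sum>k<Suc K. C k * g ^ k)"
    using K top by (intro sum.mono_neutral_right) (auto simp: not_less_eq)
  then have eq: "C K * g ^ K = - (\<Sum>k<K. C k * g ^ k)"
    using 0 by (simp add: eq_neg_iff_add_eq_0 add.commute)
  have "K \<noteq> 0"
    using eq K(2) by (cases "K = 0") auto
  then obtain K' where K': "K = Suc K'" by (cases K) auto
  have "K * total_deg g \<le> total_deg (C K * g ^ K)"
    using K(2) g0 by (simp add: total_deg_mult total_deg_power)
  also have "\<dots> = total_deg (\<Sum>k<K. C k * g ^ k)"
    unfolding eq by (simp add: total_deg_def)
  also have "\<dots> \<le> D + K' * total_deg g"
  proof (rule total_deg_sum_le)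
    fix k assume k: "k \<in> {..<K}"
    have "total_deg (C k * g ^ k) \<le> total_deg (C k) + total_deg (g ^ k)"
      by (rule total_deg_mult_le)
    also have "\<dots> \<le> D + k * total_deg g"
      using k K(1) D[of k] total_deg_power_le[of g k] by auto
    also have "\<dots> \<le> D + K' * total_deg g"
      using k K' by (auto intro!: mult_right_mono)
    finally show "total_deg (C k * g ^ k) \<le> D + K' * total_deg g" .
  qed
  finally show False using gD K' by simp
qed

text \<open>Passes from vectors of length \<open>n\<close> to valuations of all variables. Since
  only variables below \<open>n\<close> occur, values at other indices cannot matter.\<close>

lemma polymap_apply_compose_eq_id_iff:
  assumes F: "F \<in> polymaps n" and G: "G \<in> polymaps n"
  shows "(\<forall>x\<in>carrier_vec n. polymap_apply F (polymap_apply G x) = x) \<longleftrightarrow>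
    (\<forall>i<n. \<forall>x. mpol_eval (\<lambda>j. mpol_eval x (G $ j)) (F $ i) = x i)"
proof -
  have *: "polymap_apply F (polymap_apply G v) $ i = mpol_eval (\<lambda>j. mpol_eval x (G $ j)) (F $ i)"
    if "i < n" "\<And>j. j < n \<Longrightarrow> v $ j = x j" for v x i
  proof -
    have "polymap_apply F (polymap_apply G v) $ i = mpol_eval (($) (polymap_apply G v)) (F $ i)"
      using polymapsD(1)[OF F] that by (simp add: polymap_apply_def)
    also have "\<dots> = mpol_eval (\<lambda>j. mpol_eval x (G $ j)) (F $ i)"
    proof (rule mpol_eval_cong)
      fix j assume "j \<in> mpol_vars (F $ i)"
      with that polymapsD(3)[OF F, of i] have j: "j < n" by auto
      have "mpol_eval (($) v) (G $ j) = mpol_eval x (G $ j)"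
        using that polymapsD(3)[OF G j] by (intro mpol_eval_cong) auto
      with j show "polymap_apply G v $ j = mpol_eval x (G $ j)"
        using polymapsD(1)[OF G] by (simp add: polymap_apply_def)
    qed
    finally show ?thesis .
  qed
  show ?thesis
  proof safe
    fix i x assume "\<forall>x\<in>carrier_vec n. polymap_apply F (polymap_apply G x) = x" "i < n"
    then show "mpol_eval (\<lambda>j. mpol_eval x (G $ j)) (F $ i) = x i"
      using *[of i "vec n x" x] by simp
  next
    fix v :: "complex vec"
    assume a: "\<forall>i<n. \<forall>x. mpol_eval (\<lambda>j. mpol_eval x (G $ j)) (F $ i) = x i" and v: "v \<in> carrier_vec n"
    show "polymap_apply F (polymap_apply G v) = v"
    proof (rule eq_vecI)
      show "dim_vec (polymap_apply F (polymap_apply G v)) = dim_vec v"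
        using v polymapsD[OF F] by (simp add: polymap_apply_def)
      fix i assume "i < dim_vec v"
      then show "polymap_apply F (polymap_apply G v) $ i = v $ i"
        using v a *[of i v "\<lambda>j. v $ j"] by auto
    qed
  qed
qed

text \<open>Counting monomials yields a nontrivial relation between \<open>x\<^sub>i\<close> and the components of \<open>F\<close> whose
  degree depends only on \<open>n\<close> and \<open>d\<close>. Substituting the inverse \<open>G\<close> exhibits \<open>G\<^sub>i\<close> as a root of a
  polynomial with coefficients of bounded degree.\<close>

lemma inverse_total_deg_bound:
  "\<exists>D. \<forall>F\<in>Omega n d. \<forall>G\<in>polymaps n.
     (\<forall>x\<in>carrier_vec n. polymap_apply F (polymap_apply G x) = x) \<longrightarrow> (\<forall>i<n. total_deg (G $ i) \<le> D)"
proof -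
  \<comment> \<open>\<open>c * B\<close> bounds the degree of the products of a power of x_i and
    powers of the components of \<open>F\<close>, all exponents below \<open>B\<close>. There are
    \<open>B * B ^ n\<close> such products but at most \<open>(c + 1) ^ n * B ^ n\<close> monomials
    of that degree, so any \<open>B\<close> above \<open>(c + 1) ^ n\<close> forces a
    relation.\<close>
  define c where "c = Suc n * Suc d"
  define B where "B = Suc ((c + 1) ^ n)"
  have "Suc (c * B) ^ n \<le> ((c + 1) * B) ^ n"
    by (intro power_mono) (auto simp: B_def)
  also have "\<dots> = (c + 1) ^ n * B ^ n" by (rule power_mult_distrib)
  also have "\<dots> < B * B ^ n" by (intro mult_strict_right_mono) (auto simp: B_def)
  finally have count: "Suc (c * B) ^ n < B * B ^ n" .
  have "total_deg (G $ i) \<le> n * B"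
    if F: "F \<in> Omega n d" and G: "G \<in> polymaps n" and i: "i < n"
      and inv: "\<forall>x\<in>carrier_vec n. polymap_apply F (polymap_apply G x) = x" for F G i
  proof -
    have Fp: "F \<in> polymaps n" and Fd: "\<And>j. j < n \<Longrightarrow> total_deg (F $ j) \<le> d"
      using F by (auto simp: Omega_def)
    define p where "p = (\<lambda>(k, m). mvar i ^ k * mon_eval (\<lambda>j. F $ j) m :: (nat, complex) mpol)"
    define A where "A = {..<B} \<times> mon_box n B"
    have mB: "mon_deg m \<le> n * B" if "m \<in> mon_box n B" for m
    proof -
      have "mon_deg m = (\<Sum>j<n. Poly_Mapping.lookup m j)"
        using that by (intro mon_deg_superset) (auto simp: mon_box_def)
      also have "\<dots> \<le> (\<Sum>j<n. B)"
        using that by (intro sum_mono) (auto simp: mon_box_def less_imp_le)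
      finally show ?thesis by simp
    qed
    have pk: "Poly_Mapping.keys (p a) \<subseteq> monomials_le n (c * B)" if a: "a \<in> A" for a
    proof -
      obtain k m where km: "a = (k, m)" "k < B" "m \<in> mon_box n B"
        using a by (auto simp: A_def)
      have vm: "v \<in> Poly_Mapping.keys m \<Longrightarrow> v < n" for v
        using km by (auto simp: mon_box_def)
      show ?thesis
      proof (rule keys_subset_monomials_le)
        have "mpol_vars (mvar i ^ k :: (nat, complex) mpol) \<subseteq> {..<n}"
          using i by (intro mpol_vars_power) auto
        moreover have "mpol_vars (mon_eval (\<lambda>j. F $ j) m) \<subseteq> {..<n}"
          using vm polymapsD(3)[OF Fp] by (intro mpol_vars_mon_eval) auto
        ultimately show "mpol_vars (p a) \<subseteq> {..<n}"
          unfolding p_def km(1) using mpol_vars_mult by fastforce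
        have "total_deg (p a) \<le> total_deg (mvar i ^ k :: (nat, complex) mpol) + total_deg (mon_eval (\<lambda>j. F $ j) m)"
          unfolding p_def km(1) by (simp add: total_deg_mult_le)
        also have "\<dots> \<le> k * 1 + mon_deg m * d"
        proof (rule add_mono)
          show "total_deg (mvar i ^ k :: (nat, complex) mpol) \<le> k * 1"
            by (intro order.trans[OF total_deg_power_le] mult_left_mono total_deg_mvar_le) auto
          show "total_deg (mon_eval (\<lambda>j. F $ j) m) \<le> mon_deg m * d"
            using vm Fd by (intro total_deg_mon_eval_le) auto
        qed
        also have "\<dots> \<le> B + n * B * d"
          using km mB[of m] by (intro add_mono mult_right_mono) auto
        also have "\<dots> \<le> c * B"
          by (simp add: c_def algebra_simps)
        finally show "total_deg (p a) \<le> c * B" .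
      qed
    qed
    have "card (monomials_le n (c * B)) < card A"
      using card_monomials_le[of n "c * B"] count by (simp add: A_def card_mon_box card_cartesian_product)
    from underdetermined_system[OF finite_monomials_le _ this, of "\<lambda>a. Poly_Mapping.lookup (p a)"]
    obtain q where q: "\<exists>a\<in>A. q a \<noteq> 0"
      "\<And>b. b \<in> monomials_le n (c * B) \<Longrightarrow> (\<Sum>a\<in>A. q a * Poly_Mapping.lookup (p a) b) = 0"
      by (auto simp: A_def)
    have rel: "(\<Sum>a\<in>A. q a * mpol_eval x (p a)) = 0" for x
    proof -
      have "(\<Sum>a\<in>A. q a * mpol_eval x (p a)) =
          (\<Sum>a\<in>A. \<Sum>b\<in>monomials_le n (c * B). q a * Poly_Mapping.lookup (p a) b * mon_eval x b)"
        by (intro sum.cong refl)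
           (simp add: mpol_eval_superset[OF finite_monomials_le pk] sum_distrib_left mult.assoc)
      also have "\<dots> = (\<Sum>b\<in>monomials_le n (c * B). (\<Sum>a\<in>A. q a * Poly_Mapping.lookup (p a) b) * mon_eval x b)"
        by (subst sum.swap) (simp add: sum_distrib_right)
      also have "\<dots> = 0" using q(2) by simp
      finally show ?thesis .
    qed
    \<comment> \<open>The relation sorted by powers of x_i. Under x = G(y) the product of components
      with exponents \<open>m\<close> becomes the monomial \<open>m\<close> in y, so
      \<open>C k\<close> is the coefficient of the \<open>k\<close>-th power of
      \<open>G $ i\<close>.\<close>
    define C where "C = (\<lambda>k. \<Sum>m\<in>mon_box n B. Poly_Mapping.single m (q (k, m)))"
    have C: "Poly_Mapping.lookup (C k) m = q (k, m)" if "m \<in> mon_box n B" for k m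
      using that by (simp add: C_def lookup_sum lookup_single when_def)
    show ?thesis
    proof (rule total_deg_root_le)
      show "\<exists>k<B. C k \<noteq> 0"
      proof -
        from q(1) obtain k m where "k < B" "m \<in> mon_box n B" "q (k, m) \<noteq> 0"
          by (auto simp: A_def)
        then show ?thesis using C[of m k] by (metis lookup_zero)
      qed
      show "total_deg (C k) \<le> n * B" for k
        unfolding C_def
        by (intro total_deg_sum_le order.trans[OF total_deg_single_le] mB)
      show "(\<Sum>k<B. C k * (G $ i) ^ k) = 0"
      proof (rule mpol_eq_0I)
        fix y :: "nat \<Rightarrow> complex"
        define x where "x = (\<lambda>j. mpol_eval y (G $ j))"
        have Fx: "mpol_eval x (F $ j) = y j" if "j < n" for j
          using inv that unfolding polymap_apply_compose_eq_id_iff[OF Fp G] x_def by auto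
        have ev: "mpol_eval x (p (k, m)) = mpol_eval y (G $ i) ^ k * mon_eval y m"
          if "m \<in> mon_box n B" for k m
        proof -
          have "mon_eval (\<lambda>v. mpol_eval x (F $ v)) m = mon_eval y m"
            using that Fx by (intro mon_eval_cong) (auto simp: mon_box_def)
          then show ?thesis
            by (simp add: p_def mpol_eval_mult mpol_eval_power mpol_eval_mon_eval x_def del: single_one)
        qed
        have "mpol_eval y (\<Sum>k<B. C k * (G $ i) ^ k) =
            (\<Sum>k<B. \<Sum>m\<in>mon_box n B. q (k, m) * mpol_eval x (p (k, m)))"
          by (simp add: mpol_eval_sum mpol_eval_mult mpol_eval_power C_def mpol_eval_single
              sum_distrib_right sum_distrib_left ev mult_ac)
        also have "\<dots> = (\<Sum>a\<in>A. q a * mpol_eval x (p a))"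
          by (simp add: A_def sum.cartesian_product split_def)
        finally show "mpol_eval y (\<Sum>k<B. C k * (G $ i) ^ k) = 0"
          by (simp add: rel)
      qed
    qed
  qed
  then show ?thesis by blast
qed

section \<open>Linear dependence of functions through evaluation determinants\<close>

text \<open>If the determinant of size \<open>N\<close> is nonzero at some points \<open>xs\<close>,
  add a free point \<open>x\<close> as last row and expand along it: the cofactors do not involve
  \<open>x\<close> and are the coefficients of a dependence.\<close>

lemma eval_dets_0_imp_dependent:
  fixes g :: "nat \<Rightarrow> 'x \<Rightarrow> 'a::idom"
  assumes "\<And>xs. det (mat N N (\<lambda>(b, a). g a (xs b))) = 0"
  shows "\<exists>c. (\<exists>a<N. c a \<noteq> 0) \<and> (\<forall>x. (\<Sum>a<N. c a * g a x) = 0)"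
  using assms
proof (induction N)
  case 0
  \<comment> \<open>The determinant of the empty matrix is 1.\<close>
  from 0[of undefined] show ?case by simp
next
  case (Suc N)
  show ?case
  proof (cases "\<forall>xs. det (mat N N (\<lambda>(b, a). g a (xs b))) = 0")
    case True
    then obtain c where c: "\<exists>a<N. c a \<noteq> 0" "\<And>x. (\<Sum>a<N. c a * g a x) = 0"
      using Suc.IH by blast
    have "(\<Sum>a<Suc N. (c(N := 0)) a * g a x) = 0" for x
      using c(2)[of x] by simp
    moreover have "\<exists>a<Suc N. (c(N := 0)) a \<noteq> 0"
      using c(1) by (auto intro: less_SucI)
    ultimately show ?thesis by blast
  next
    case False
    then obtain xs where xs: "det (mat N N (\<lambda>(b, a). g a (xs b))) \<noteq> 0" by blast
    \<comment> \<open>Cofactors of the last row; the one in column \<open>N\<close> is the nonzero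
      determinant at \<open>xs\<close>.\<close>
    define c where "c = (\<lambda>a. (-1) ^ (N + a) *
      det (mat N N (\<lambda>(b, a'). g (if a' < a then a' else Suc a') (xs b))))"
    have "mat N N (\<lambda>(b, a'). g (if a' < N then a' else Suc a') (xs b)) = mat N N (\<lambda>(b, a). g a (xs b))"
      by (rule eq_matI) auto
    then have "c N \<noteq> 0" using xs by (simp add: c_def)
    moreover have "(\<Sum>a<Suc N. c a * g a x) = 0" for x
    proof -
      define A where "A = mat (Suc N) (Suc N) (\<lambda>(b, a). g a ((xs(N := x)) b))"
      have del: "mat_delete A N a = mat N N (\<lambda>(b, a'). g (if a' < a then a' else Suc a') (xs b))" for a
        by (rule eq_matI) (auto simp: A_def mat_delete_def)
      have row: "A $$ (N, a) = g a x" if "a < Suc N" for a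
        using that by (simp add: A_def)
      have "det A = (\<Sum>a<Suc N. A $$ (N, a) * cofactor A N a)"
        by (rule laplace_expansion_row) (auto simp: A_def)
      also have "\<dots> = (\<Sum>a<Suc N. c a * g a x)"
        by (intro sum.cong) (simp_all add: cofactor_def del c_def row)
      finally show ?thesis
        using Suc.prems[of "xs(N := x)"] by (simp add: A_def)
    qed
    ultimately show ?thesis by blast
  qed
qed

text \<open>The coefficient vector lies in the kernel of every evaluation matrix.\<close>

lemma dependent_imp_eval_det_0:
  fixes g :: "nat \<Rightarrow> 'x \<Rightarrow> 'a::idom"
  assumes "\<exists>a<N. c a \<noteq> 0" "\<And>x. (\<Sum>a<N. c a * g a x) = 0"
  shows "det (mat N N (\<lambda>(b, a). g a (xs b))) = 0"
proof -
  have "mat N N (\<lambda>(b, a). g a (xs b)) *\<^sub>v vec N c = 0\<^sub>v N"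
    using assms(2) by (intro eq_vecI) (auto simp: scalar_prod_def atLeast0LessThan mult.commute)
  moreover have "vec N c \<noteq> 0\<^sub>v N"
    using assms(1) by (auto simp: vec_eq_iff)
  ultimately show ?thesis
    by (subst det_0_iff_vec_prod_zero[of _ N]) (auto intro!: exI[of _ "vec N c"])
qed

section \<open>Regular functions on the coefficient space\<close>

text \<open>The coordinate ring of \<open>Omega n d\<close>, as functions of which only the values
  on \<open>Omega n d\<close> count. Closure rules then recognise a determinant or an evaluation as
  regular without exhibiting its polynomial.\<close>

definition regular_fun :: "nat \<Rightarrow> nat \<Rightarrow> (polymap \<Rightarrow> complex) set" where
  "regular_fun n d = {f. \<exists>Q\<in>coord_polys n d. \<forall>F\<in>Omega n d. f F = mpol_eval (coeff_vec F) Q}"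

lemma regular_funI:
  "Q \<in> coord_polys n d \<Longrightarrow> (\<And>F. F \<in> Omega n d \<Longrightarrow> f F = mpol_eval (coeff_vec F) Q) \<Longrightarrow> f \<in> regular_fun n d"
  by (auto simp: regular_fun_def)

lemma regular_fun_cong:
  "f \<in> regular_fun n d \<Longrightarrow> (\<And>F. F \<in> Omega n d \<Longrightarrow> g F = f F) \<Longrightarrow> g \<in> regular_fun n d"
  by (auto simp: regular_fun_def)

lemma regular_fun_const: "(\<lambda>_. c) \<in> regular_fun n d"
  by (rule regular_funI[of "mconst c"]) (auto simp: coord_polys_def)

lemma regular_fun_coeff:
  assumes "i < n" "m \<in> monomials_le n d"
  shows "(\<lambda>F. Poly_Mapping.lookup (F $ i) m) \<in> regular_fun n d"
  using assms
  by (intro regular_funI[of "mvar (i, m)"])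
     (auto simp: coord_polys_def coords_def monomials_le_def coeff_vec_def)

lemma regular_fun_add:
  assumes "f \<in> regular_fun n d" "g \<in> regular_fun n d"
  shows "(\<lambda>F. f F + g F) \<in> regular_fun n d"
proof -
  obtain P Q where "P \<in> coord_polys n d" "\<And>F. F \<in> Omega n d \<Longrightarrow> f F = mpol_eval (coeff_vec F) P"
    "Q \<in> coord_polys n d" "\<And>F. F \<in> Omega n d \<Longrightarrow> g F = mpol_eval (coeff_vec F) Q"
    using assms unfolding regular_fun_def by blast
  then show ?thesis
    using mpol_vars_add[of P Q]
    by (intro regular_funI[of "P + Q"]) (auto simp: coord_polys_def mpol_eval_add)
qed

lemma regular_fun_mult:
  assumes "f \<in> regular_fun n d" "g \<in> regular_fun n d"
  shows "(\<lambda>F. f F * g F) \<in> regular_fun n d"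
proof -
  obtain P Q where "P \<in> coord_polys n d" "\<And>F. F \<in> Omega n d \<Longrightarrow> f F = mpol_eval (coeff_vec F) P"
    "Q \<in> coord_polys n d" "\<And>F. F \<in> Omega n d \<Longrightarrow> g F = mpol_eval (coeff_vec F) Q"
    using assms unfolding regular_fun_def by blast
  then show ?thesis
    using mpol_vars_mult[of P Q]
    by (intro regular_funI[of "P * Q"]) (auto simp: coord_polys_def mpol_eval_mult)
qed

lemma regular_fun_sum:
  "(\<And>a. a \<in> A \<Longrightarrow> f a \<in> regular_fun n d) \<Longrightarrow> (\<lambda>F. \<Sum>a\<in>A. f a F) \<in> regular_fun n d"
  by (induction A rule: infinite_finite_induct) (auto intro: regular_fun_add regular_fun_const)

lemma regular_fun_prod:
  "(\<And>a. a \<in> A \<Longrightarrow> f a \<in> regular_fun n d) \<Longrightarrow> (\<lambda>F. \<Prod>a\<in>A. f a F) \<in> regular_fun n d"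
  by (induction A rule: infinite_finite_induct) (auto intro: regular_fun_mult regular_fun_const)

lemma regular_fun_power: "f \<in> regular_fun n d \<Longrightarrow> (\<lambda>F. f F ^ k) \<in> regular_fun n d"
  by (induction k) (auto intro: regular_fun_mult regular_fun_const)

lemma regular_fun_mon_eval:
  "(\<And>v. v \<in> Poly_Mapping.keys m \<Longrightarrow> f v \<in> regular_fun n d) \<Longrightarrow>
    (\<lambda>F. mon_eval (\<lambda>v. f v F) m) \<in> regular_fun n d"
  unfolding mon_eval_def by (intro regular_fun_prod regular_fun_power)

lemma regular_fun_mpol_eval:
  "(\<And>v. v \<in> mpol_vars Q \<Longrightarrow> f v \<in> regular_fun n d) \<Longrightarrow>
    (\<lambda>F. mpol_eval (\<lambda>v. f v F) Q) \<in> regular_fun n d"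
  unfolding mpol_eval_def
  by (intro regular_fun_sum regular_fun_mult regular_fun_const regular_fun_mon_eval)
     (auto simp: mpol_vars_def)

lemma regular_fun_det:
  assumes "\<And>a b. a < N \<Longrightarrow> b < N \<Longrightarrow> f a b \<in> regular_fun n d"
  shows "(\<lambda>F. det (mat N N (\<lambda>(a, b). f a b F))) \<in> regular_fun n d"
proof (rule regular_fun_cong)
  show "(\<lambda>F. \<Sum>p\<in>{p. p permutes {0..<N}}. signof p * (\<Prod>a = 0..<N. f a (p a) F)) \<in> regular_fun n d"
  proof (intro regular_fun_sum regular_fun_mult regular_fun_const regular_fun_prod assms)
    fix p a assume "p \<in> {p. p permutes {0..<N}}" "a \<in> {0..<N}"
    then show "p a < N" using permutes_in_image[of p "{0..<N}" a] by auto
  qed auto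
  show "det (mat N N (\<lambda>(a, b). f a b F)) =
      (\<Sum>p\<in>{p. p permutes {0..<N}}. signof p * (\<Prod>a = 0..<N. f a (p a) F))" for F
  proof (subst det_def'[of _ N], simp, intro sum.cong refl arg_cong2[of _ _ _ _ "(*)"] prod.cong)
    fix p a assume "p \<in> {p. p permutes {0..<N}}" "a \<in> {0..<N}"
    then show "mat N N (\<lambda>(a, b). f a b F) $$ (a, p a) = f a (p a) F"
      using permutes_in_image[of p "{0..<N}" a] by auto
  qed
qed

lemma keys_subset_of_Omega:
  assumes "F \<in> Omega n d" "i < n"
  shows "Poly_Mapping.keys (F $ i) \<subseteq> monomials_le n d"
  using assms by (intro keys_subset_monomials_le) (auto simp: Omega_def polymaps_def)

text \<open>Evaluation is linear in the coefficients, and on \<open>Omega n d\<close> the sum runs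
  over one fixed finite set of monomials.\<close>

lemma regular_fun_eval_at:
  assumes "i < n"
  shows "(\<lambda>F. mpol_eval x (F $ i)) \<in> regular_fun n d"
proof (rule regular_fun_cong)
  show "(\<lambda>F. \<Sum>m\<in>monomials_le n d. Poly_Mapping.lookup (F $ i) m * mon_eval x m) \<in> regular_fun n d"
    using assms by (intro regular_fun_sum regular_fun_mult regular_fun_const regular_fun_coeff)
  show "mpol_eval x (F $ i) = (\<Sum>m\<in>monomials_le n d. Poly_Mapping.lookup (F $ i) m * mon_eval x m)"
    if "F \<in> Omega n d" for F
    using that assms by (intro mpol_eval_superset finite_monomials_le keys_subset_of_Omega)
qed

lemma closedin_zariski_regular:
  assumes "S \<subseteq> regular_fun n d"
  shows "closedin (zariski n d) {F \<in> Omega n d. \<forall>f\<in>S. f F = 0}"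
proof -
  have "\<forall>f\<in>S. \<exists>Q. Q \<in> coord_polys n d \<and> (\<forall>F\<in>Omega n d. f F = mpol_eval (coeff_vec F) Q)"
    using assms by (fastforce simp: regular_fun_def)
  then obtain q where q: "\<forall>f\<in>S. q f \<in> coord_polys n d \<and> (\<forall>F\<in>Omega n d. f F = mpol_eval (coeff_vec F) (q f))"
    by (auto dest: bchoice)
  then have "{F \<in> Omega n d. \<forall>f\<in>S. f F = 0} = zero_locus n d (q ` S)" "q ` S \<subseteq> coord_polys n d"
    by (auto simp: zero_locus_def)
  then show ?thesis unfolding closedin_zariski by blast
qed

lemma closedin_zariskiE:
  assumes "closedin (zariski n d) A"
  obtains S where "S \<subseteq> regular_fun n d" "A = {F \<in> Omega n d. \<forall>f\<in>S. f F = 0}"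
proof -
  obtain R where R: "R \<subseteq> coord_polys n d" "A = zero_locus n d R"
    using assms by (auto simp: closedin_zariski)
  define S where "S = (\<lambda>Q F. mpol_eval (coeff_vec F) Q) ` R"
  have "S \<subseteq> regular_fun n d"
    using R(1) by (auto simp: S_def intro!: regular_funI)
  moreover have "A = {F \<in> Omega n d. \<forall>f\<in>S. f F = 0}"
    by (auto simp: R(2) zero_locus_def S_def)
  ultimately show ?thesis by (rule that)
qed

section \<open>The automorphisms form a closed subset\<close>

text \<open>Composition has to exist as a polynomial, because algebraic independence is applied to
  the difference of F \<circ> G and the identity.\<close>

definition mpol_subst :: "('v \<Rightarrow> ('w, 'a::comm_semiring_1) mpol) \<Rightarrow> ('v, 'a) mpol \<Rightarrow> ('w, 'a) mpol" where
  "mpol_subst f p = (\<Sum>m\<in>Poly_Mapping.keys p. mconst (Poly_Mapping.lookup p m) * mon_eval f m)"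

lemma mpol_eval_subst: "mpol_eval x (mpol_subst f p) = mpol_eval (\<lambda>v. mpol_eval x (f v)) p"
  unfolding mpol_subst_def mpol_eval_sum mpol_eval_mult mpol_eval_mon_eval mpol_eval_mconst
  by (simp add: mpol_eval_def)

lemma mpol_vars_subst:
  assumes "\<And>v. v \<in> mpol_vars p \<Longrightarrow> mpol_vars (f v) \<subseteq> V"
  shows "mpol_vars (mpol_subst f p) \<subseteq> V"
  unfolding mpol_subst_def
proof (rule mpol_vars_sum)
  fix m assume m: "m \<in> Poly_Mapping.keys p"
  have "mpol_vars (mon_eval f m) \<subseteq> V"
    using m assms by (intro mpol_vars_mon_eval) (auto simp: mpol_vars_def)
  then show "mpol_vars (mconst (Poly_Mapping.lookup p m) * mon_eval f m) \<subseteq> V"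
    using mpol_vars_mult[of "mconst (Poly_Mapping.lookup p m)" "mon_eval f m"] by auto
qed

text \<open>By algebraic independence \<open>(F \<circ> G - id) \<circ> F = 0\<close> implies \<open>F \<circ> G = id\<close>.\<close>

lemma left_inverse_imp_right_inverse:
  assumes F: "F \<in> polymaps n" "Jac F = 1" and G: "G \<in> polymaps n"
    and GF: "\<And>i x. i < n \<Longrightarrow> mpol_eval (\<lambda>j. mpol_eval x (F $ j)) (G $ i) = x i"
    and i: "i < n"
  shows "mpol_eval (\<lambda>j. mpol_eval y (G $ j)) (F $ i) = y i"
proof -
  define P where "P = mpol_subst (\<lambda>j. G $ j) (F $ i) + mconst (-1) * mvar i"
  have "P = 0"
  proof (rule Jac_1_imp_alg_independent[OF F])
    have "mpol_vars (mpol_subst (\<lambda>j. G $ j) (F $ i)) \<subseteq> {..<n}"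
      using polymapsD(3)[OF F(1) i] polymapsD(3)[OF G] by (intro mpol_vars_subst) auto
    moreover have "mpol_vars (mconst (-1) * mvar i :: (nat, complex) mpol) \<subseteq> {..<n}"
      by (rule order.trans[OF mpol_vars_mult]) (simp add: i)
    ultimately show "mpol_vars P \<subseteq> {..<n}"
      unfolding P_def using mpol_vars_add by fastforce
  next
    fix x
    define z where "z = (\<lambda>j. mpol_eval x (F $ j))"
    have "mpol_eval (\<lambda>j. mpol_eval z (G $ j)) (F $ i) = mpol_eval x (F $ i)"
      using polymapsD(3)[OF F(1) i] GF by (intro mpol_eval_cong) (auto simp: z_def)
    then show "mpol_eval (\<lambda>j. mpol_eval x (F $ j)) P = 0"
      by (simp add: P_def mpol_eval_add mpol_eval_mult mpol_eval_subst flip: z_def)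
         (simp add: z_def)
  qed
  then have "mpol_eval y P = 0" by simp
  then show ?thesis by (simp add: P_def mpol_eval_add mpol_eval_mult mpol_eval_subst)
qed

text \<open>With inverses of degree at most \<open>D\<close>, a Keller map \<open>F\<close> is an automorphism iff each \<open>x\<^sub>i\<close> is
  linearly dependent on the (always independent) products \<open>F\<^sup>m\<close> with \<open>|m| \<le> D\<close>, which is the
  vanishing of evaluation determinants.\<close>

lemma closedin_automorphisms:
  "\<exists>A. closedin (zariski n d) A \<and> (\<forall>F\<in>Keller n d. F \<in> A \<longleftrightarrow> poly_automorphism n F)"
proof -
  obtain D where D: "\<And>F G i. F \<in> Omega n d \<Longrightarrow> G \<in> polymaps n \<Longrightarrow>
     (\<forall>x\<in>carrier_vec n. polymap_apply F (polymap_apply G x) = x) \<Longrightarrow> i < n \<Longrightarrow> total_deg (G $ i) \<le> D"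
    using inverse_total_deg_bound by metis
  define N where "N = card (monomials_le n D)"
  obtain e where e: "bij_betw e {..<N} (monomials_le n D)"
    using ex_bij_betw_nat_finite[OF finite_monomials_le[of n D]] by (auto simp: N_def atLeast0LessThan)
  have ek: "a < N \<Longrightarrow> e a \<in> monomials_le n D" for a
    using e by (auto simp: bij_betw_def)
  \<comment> \<open>Indices below \<open>N\<close> enumerate the products of components of
    \<open>F\<close>; index \<open>N\<close> is the coordinate function x_i.\<close>
  define g where "g = (\<lambda>i (F :: polymap) a (x :: nat \<Rightarrow> complex). if a < N then mon_eval (\<lambda>j. mpol_eval x (F $ j)) (e a) else x i)"
  define \<Delta> where "\<Delta> = (\<lambda>i xs F. det (mat (Suc N) (Suc N) (\<lambda>(b, a). g i F a (xs b))))"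
  define S where "S = {\<Delta> i xs | i xs. i < n}"
  \<comment> \<open>Outside \<open>Keller n d\<close> this set may contain maps that are not
    automorphisms, since there the products can be dependent among themselves.\<close>
  define A where "A = {F \<in> Omega n d. \<forall>f\<in>S. f F = 0}"
  have "\<Delta> i xs \<in> regular_fun n d" if "i < n" for i xs
    unfolding \<Delta>_def
  proof (rule regular_fun_det)
    fix a b
    show "(\<lambda>F. g i F b (xs a)) \<in> regular_fun n d"
    proof (cases "b < N")
      case True
      then have "Poly_Mapping.keys (e b) \<subseteq> {..<n}"
        using ek by (auto simp: monomials_le_def)
      with True show ?thesis
        by (auto simp: g_def intro!: regular_fun_mon_eval regular_fun_eval_at)
    next
      case False
      then show ?thesis by (simp add: g_def regular_fun_const)
    qed
  qed
  then have "closedin (zariski n d) A"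
    unfolding A_def by (intro closedin_zariski_regular) (auto simp: S_def)
  moreover have "F \<in> A \<longleftrightarrow> poly_automorphism n F" if F: "F \<in> Keller n d" for F
  proof
    have FO: "F \<in> Omega n d" and Fp: "F \<in> polymaps n" and FJ: "Jac F = 1"
      using F by (auto simp: Keller_def Omega_def)
    {
      assume FA: "F \<in> A"
      have "\<exists>p. mpol_vars p \<subseteq> {..<n} \<and> (\<forall>x. mpol_eval (\<lambda>j. mpol_eval x (F $ j)) p = x i)"
        if i: "i < n" for i
      proof -
        have "\<Delta> i xs F = 0" for xs
          using FA i by (auto simp: A_def S_def)
        then obtain c where c: "\<exists>a<Suc N. c a \<noteq> 0" "\<And>x. (\<Sum>a<Suc N. c a * g i F a x) = 0"
          using eval_dets_0_imp_dependent[of "Suc N" "g i F"] unfolding \<Delta>_def by blast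
        define Q where "Q = (\<Sum>a<N. Poly_Mapping.single (e a) (c a))"
        have vars: "mpol_vars (\<Sum>a<N. Poly_Mapping.single (e a) (h a :: complex)) \<subseteq> {..<n}" for h
          using ek by (intro mpol_vars_sum order.trans[OF mpol_vars_single]) (auto simp: monomials_le_def)
        have ev: "mpol_eval (\<lambda>j. mpol_eval x (F $ j)) Q = - c N * x i" for x
          using c(2)[of x] by (simp add: Q_def mpol_eval_sum mpol_eval_single g_def add_eq_0_iff)
        \<comment> \<open>Otherwise the products alone would be dependent, against algebraic
          independence. Dividing by \<open>c N\<close> then writes x_i as a polynomial in the
          components of \<open>F\<close>, which is component \<open>i\<close> of the
          inverse.\<close>
        have "c N \<noteq> 0"
        proof
          assume cN: "c N = 0"
          have "Q = 0"
            using ev cN vars[of c] by (intro Jac_1_imp_alg_independent[OF Fp FJ]) (auto simp: Q_def)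
          have "c a = 0" if a: "a < N" for a
          proof -
            have "e b = e a \<longleftrightarrow> b = a" if "b < N" for b
              using e a that by (auto simp: bij_betw_def dest: inj_onD)
            then have "Poly_Mapping.lookup Q (e a) = (\<Sum>b<N. if b = a then c b else 0)"
              unfolding Q_def lookup_sum by (intro sum.cong) (auto simp: lookup_single when_def)
            with a \<open>Q = 0\<close> show ?thesis by simp
          qed
          with c(1) cN show False by (auto simp: less_Suc_eq)
        qed
        define p where "p = (\<Sum>a<N. Poly_Mapping.single (e a) (- c a / c N))"
        have "mpol_eval (\<lambda>j. mpol_eval x (F $ j)) p = - mpol_eval (\<lambda>j. mpol_eval x (F $ j)) Q / c N" for x
          by (simp add: p_def Q_def mpol_eval_sum mpol_eval_single sum_divide_distrib sum_negf)
        then have "mpol_eval (\<lambda>j. mpol_eval x (F $ j)) p = x i" for x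
          using ev \<open>c N \<noteq> 0\<close> by simp
        moreover have "mpol_vars p \<subseteq> {..<n}"
          unfolding p_def by (rule vars)
        ultimately show ?thesis by blast
      qed
      then obtain p where p: "\<And>i. i < n \<Longrightarrow> mpol_vars (p i) \<subseteq> {..<n}"
        "\<And>i x. i < n \<Longrightarrow> mpol_eval (\<lambda>j. mpol_eval x (F $ j)) (p i) = x i"
        by metis
      define G :: polymap where "G = vec n p"
      have G: "G \<in> polymaps n"
        using p(1) by (auto simp: G_def polymaps_def)
      have GF: "mpol_eval (\<lambda>j. mpol_eval x (F $ j)) (G $ i) = x i" if "i < n" for i x
        using p(2) that by (simp add: G_def)
      have FG: "mpol_eval (\<lambda>j. mpol_eval x (G $ j)) (F $ i) = x i" if "i < n" for i x
        using left_inverse_imp_right_inverse[OF Fp FJ G GF that] .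
      show "poly_automorphism n F"
        unfolding poly_automorphism_def
        using Fp G polymap_apply_compose_eq_id_iff[OF Fp G] polymap_apply_compose_eq_id_iff[OF G Fp] FG GF
        by blast
    }
    {
      assume "poly_automorphism n F"
      then obtain G where G: "G \<in> polymaps n"
        and GF: "\<forall>x\<in>carrier_vec n. polymap_apply G (polymap_apply F x) = x"
        and FG: "\<forall>x\<in>carrier_vec n. polymap_apply F (polymap_apply G x) = x"
        unfolding poly_automorphism_def by blast
      have "\<Delta> i xs F = 0" if i: "i < n" for i xs
        unfolding \<Delta>_def
      proof (rule dependent_imp_eval_det_0)
        define c where "c = (\<lambda>a. if a < N then Poly_Mapping.lookup (G $ i) (e a) else -1)"
        show "\<exists>a<Suc N. c a \<noteq> 0"
          by (intro exI[of _ N]) (simp add: c_def)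
        fix x
        have "x i = mpol_eval (\<lambda>j. mpol_eval x (F $ j)) (G $ i)"
          using GF i unfolding polymap_apply_compose_eq_id_iff[OF G Fp] by simp
        also have "\<dots> = (\<Sum>m\<in>monomials_le n D.
            Poly_Mapping.lookup (G $ i) m * mon_eval (\<lambda>j. mpol_eval x (F $ j)) m)"
          using polymapsD(3)[OF G i] D[OF FO G FG i]
          by (intro mpol_eval_superset finite_monomials_le keys_subset_monomials_le)
        also have "\<dots> = (\<Sum>a<N. c a * g i F a x)"
          by (subst sum.reindex_bij_betw[OF e, symmetric]) (simp add: c_def g_def)
        finally show "(\<Sum>a<Suc N. c a * g i F a x) = 0"
          by (simp add: c_def g_def)
      qed
      then show "F \<in> A"
        using FO by (auto simp: A_def S_def)
    }
  qed
  ultimately show ?thesis by blast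
qed

section \<open>Irreducible sets\<close>

text \<open>Closed sets of a subspace are traces of closed sets. This allows all arguments about
  subsets of \<open>Keller n d\<close> to take place in \<open>zariski n d\<close>.\<close>

lemma irreducible_in_subtopology:
  "irreducible_in (subtopology T X) S \<longleftrightarrow> S \<subseteq> X \<and> irreducible_in T S"
proof
  assume *: "irreducible_in (subtopology T X) S"
  then have S: "S \<subseteq> topspace T" "S \<subseteq> X" "S \<noteq> {}"
    by (auto simp: irreducible_in_def)
  have "S \<subseteq> A \<or> S \<subseteq> B" if "closedin T A" "closedin T B" "S \<subseteq> A \<union> B" for A B
  proof -
    have "closedin (subtopology T X) (A \<inter> X)" "closedin (subtopology T X) (B \<inter> X)"
      using that by (auto simp: closedin_subtopology)
    moreover have "S \<subseteq> A \<inter> X \<union> B \<inter> X" using S that by auto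
    ultimately have "S \<subseteq> A \<inter> X \<or> S \<subseteq> B \<inter> X"
      using * unfolding irreducible_in_def by blast
    then show ?thesis by blast
  qed
  then show "S \<subseteq> X \<and> irreducible_in T S"
    using S by (simp add: irreducible_in_def)
next
  assume *: "S \<subseteq> X \<and> irreducible_in T S"
  have "S \<subseteq> A \<or> S \<subseteq> B"
    if A: "closedin (subtopology T X) A" and B: "closedin (subtopology T X) B" and AB: "S \<subseteq> A \<union> B"
    for A B
  proof -
    obtain A' B' where A': "closedin T A'" "A = A' \<inter> X" and B': "closedin T B'" "B = B' \<inter> X"
      using A B by (auto simp: closedin_subtopology)
    then have "S \<subseteq> A' \<or> S \<subseteq> B'"
      using * AB unfolding irreducible_in_def by blast
    then show ?thesis using * A' B' by blast
  qed
  moreover have "S \<subseteq> topspace (subtopology T X)" "S \<noteq> {}"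
    using * by (auto simp: irreducible_in_def)
  ultimately show "irreducible_in (subtopology T X) S"
    unfolding irreducible_in_def by blast
qed

lemma irreducible_in_subset_closure:
  assumes "irreducible_in T S" "S \<subseteq> Z" "Z \<subseteq> T closure_of S"
  shows "irreducible_in T Z"
  unfolding irreducible_in_def
proof (intro conjI allI impI)
  show "Z \<subseteq> topspace T"
    by (rule order.trans[OF assms(3) closure_of_subset_topspace])
  show "Z \<noteq> {}" using assms by (auto simp: irreducible_in_def)
  fix A B assume AB: "closedin T A \<and> closedin T B \<and> Z \<subseteq> A \<union> B"
  then have "S \<subseteq> A \<or> S \<subseteq> B"
    using assms(1,2) unfolding irreducible_in_def by blast
  then show "Z \<subseteq> A \<or> Z \<subseteq> B"
    using assms(3) AB closure_of_minimal[of S A T] closure_of_minimal[of S B T] by blast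
qed

text \<open>\<open>S\<close> is covered by the closure of \<open>U\<close> and the complement of
  \<open>U\<close>, and the complement is not all of \<open>S\<close>.\<close>

lemma irreducible_in_open_dense:
  assumes "irreducible_in T S" "openin (subtopology T S) U" "U \<noteq> {}"
  shows "(subtopology T S) closure_of U = S"
proof -
  let ?C = "(subtopology T S) closure_of U"
  have S: "topspace (subtopology T S) = S"
    using assms(1) by (auto simp: irreducible_in_def)
  have US: "U \<subseteq> S" using openin_subset[OF assms(2)] S by simp
  have "irreducible_in (subtopology T S) S"
    using assms(1) by (simp add: irreducible_in_subtopology)
  moreover have "closedin (subtopology T S) (S - U)"
    using assms(2) S by (simp add: closedin_def double_diff US)
  moreover have "S \<subseteq> ?C \<union> (S - U)"
    using closure_of_subset[of U "subtopology T S"] US S by auto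
  ultimately have "S \<subseteq> ?C \<or> S \<subseteq> S - U"
    unfolding irreducible_in_def by (meson closedin_closure_of)
  then have "S \<subseteq> ?C" using assms(3) US by auto
  then show ?thesis
    using closure_of_subset_topspace[of "subtopology T S" U] S by auto
qed

section \<open>Shears\<close>

text \<open>Component \<open>n\<close> of a polynomial map of \<open>\<complex>\<^sup>n\<close> is by convention the constant \<open>1\<close>, so that
  translations become shears as well.\<close>

definition ext_comp :: "nat \<Rightarrow> polymap \<Rightarrow> nat \<Rightarrow> (nat, complex) mpol" where
  "ext_comp n F j = (if j < n then F $ j else 1)"

definition shear :: "nat \<Rightarrow> nat \<Rightarrow> nat \<Rightarrow> complex \<Rightarrow> polymap \<Rightarrow> polymap" where
  "shear n i j t F = vec n (\<lambda>k. if k = i then F $ i + mconst t * ext_comp n F j else F $ k)"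

lemma mpol_vars_ext_comp: "F \<in> polymaps n \<Longrightarrow> mpol_vars (ext_comp n F j) \<subseteq> {..<n}"
  using polymapsD(3)[of F n j] by (auto simp: ext_comp_def)

lemma shear_in_Omega:
  assumes F: "F \<in> Omega n d" and i: "i < n"
  shows "shear n i j t F \<in> Omega n d"
proof -
  have Fp: "F \<in> polymaps n" and Fd: "\<And>k. k < n \<Longrightarrow> total_deg (F $ k) \<le> d"
    using F by (auto simp: Omega_def)
  have "mpol_vars (mconst t * ext_comp n F j) \<subseteq> {..<n}"
    by (rule order.trans[OF mpol_vars_mult]) (use mpol_vars_ext_comp[OF Fp] in auto)
  then have v: "mpol_vars (F $ i + mconst t * ext_comp n F j) \<subseteq> {..<n}"
    using mpol_vars_add[of "F $ i" "mconst t * ext_comp n F j"] polymapsD(3)[OF Fp i] by blast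
  have "total_deg (ext_comp n F j) \<le> d"
    using Fd by (auto simp: ext_comp_def)
  then have "total_deg (mconst t * ext_comp n F j) \<le> d"
    using total_deg_mult_le[of "mconst t" "ext_comp n F j"] by simp
  then have "total_deg (F $ i + mconst t * ext_comp n F j) \<le> d"
    using Fd[OF i] by (intro total_deg_add_le)
  with v show ?thesis
    using Fd polymapsD(3)[OF Fp] by (auto simp: Omega_def polymaps_def shear_def)
qed

text \<open>On the Jacobian matrix a linear shear is a row operation, and a translation changes
  nothing.\<close>

lemma Jac_shear:
  assumes F: "F \<in> polymaps n" and i: "i < n" and ij: "i \<noteq> j"
  shows "Jac (shear n i j t F) = Jac F"
proof -
  define A where "A = mat n n (\<lambda>(k, l). mpol_pderiv l (F $ k))"
  define B where "B = mat n n (\<lambda>(k, l). mpol_pderiv l (shear n i j t F $ k))"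
  have "det B = det A"
  proof (cases "j < n")
    case True
    have "B = addrow (mconst t) i j A"
      using i True
      by (intro eq_matI) (auto simp: A_def B_def shear_def ext_comp_def mpol_pderiv_add mpol_pderiv_mconst_mult)
    then show ?thesis
      using True ij by (simp add: det_addrow[of _ n] A_def)
  next
    case False
    then have "B = A"
      using i by (intro eq_matI) (auto simp: A_def B_def shear_def ext_comp_def mpol_pderiv_add)
    then show ?thesis by simp
  qed
  then show ?thesis
    using polymapsD(1)[OF F] by (simp add: Jac_def A_def B_def shear_def)
qed

lemma shear_in_Keller:
  assumes "F \<in> Keller n d" "i < n" "i \<noteq> j"
  shows "shear n i j t F \<in> Keller n d"
proof -
  have "F \<in> Omega n d" "F \<in> polymaps n" "Jac F = 1"
    using assms(1) by (auto simp: Keller_def Omega_def)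
  then show ?thesis
    using assms by (simp add: Keller_def shear_in_Omega Jac_shear)
qed

lemma shear_0: "F \<in> Omega n d \<Longrightarrow> shear n i j 0 F = F"
  by (intro eq_vecI) (auto simp: shear_def Omega_def polymaps_def)

lemma coeff_vec_shear:
  assumes "k < n"
  shows "coeff_vec (shear n i j t F) (k, m) =
    coeff_vec F (k, m) + (if k = i then t * Poly_Mapping.lookup (ext_comp n F j) m else 0)"
  using assms by (simp add: coeff_vec_def shear_def lookup_add lookup_mconst_mult)

lemma regular_fun_coeff_ext_comp:
  assumes "m \<in> monomials_le n d"
  shows "(\<lambda>F. Poly_Mapping.lookup (ext_comp n F j) m) \<in> regular_fun n d"
proof (cases "j < n")
  case True
  with assms show ?thesis by (simp add: ext_comp_def regular_fun_coeff)
next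
  case False
  then show ?thesis by (simp add: ext_comp_def regular_fun_const)
qed

lemma regular_fun_shear:
  assumes f: "f \<in> regular_fun n d" and i: "i < n"
  shows "(\<lambda>F. f (shear n i j t F)) \<in> regular_fun n d"
proof -
  obtain Q where Q: "Q \<in> coord_polys n d" "\<And>F. F \<in> Omega n d \<Longrightarrow> f F = mpol_eval (coeff_vec F) Q"
    using f by (auto simp: regular_fun_def)
  have "(\<lambda>F. mpol_eval (\<lambda>v. coeff_vec (shear n i j t F) v) Q) \<in> regular_fun n d"
  proof (rule regular_fun_mpol_eval)
    fix v assume "v \<in> mpol_vars Q"
    then obtain k m where v: "v = (k, m)" "k < n" "m \<in> monomials_le n d"
      using Q(1) by (auto simp: coord_polys_def coords_def monomials_le_def)
    have "(\<lambda>F. (if k = i then t * Poly_Mapping.lookup (ext_comp n F j) m else 0)) \<in> regular_fun n d"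
      using v(3) by (cases "k = i") (auto intro: regular_fun_const regular_fun_mult regular_fun_coeff_ext_comp)
    moreover have "(\<lambda>F. coeff_vec F (k, m)) \<in> regular_fun n d"
      using v by (simp add: coeff_vec_def regular_fun_coeff)
    ultimately show "(\<lambda>F. coeff_vec (shear n i j t F) v) \<in> regular_fun n d"
      unfolding v(1) coeff_vec_shear[OF v(2)] by (rule regular_fun_add[rotated])
  qed
  then show ?thesis
    by (rule regular_fun_cong) (simp add: Q(2) shear_in_Omega i)
qed

text \<open>The coefficients of the sheared map have degree at most 1 in \<open>t\<close>. Hence a
  regular function that is nonzero somewhere on the line has only finitely many zeros on it.\<close>

lemma poly_along_shear:
  assumes f: "f \<in> regular_fun n d" and F: "F \<in> Omega n d" and i: "i < n"
  shows "\<exists>q. \<forall>t. poly q t = f (shear n i j t F)"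
proof -
  obtain Q where Q: "Q \<in> coord_polys n d" "\<And>F. F \<in> Omega n d \<Longrightarrow> f F = mpol_eval (coeff_vec F) Q"
    using f by (auto simp: regular_fun_def)
  define h where "h = (\<lambda>(k, m). [:coeff_vec F (k, m),
    if k = i then Poly_Mapping.lookup (ext_comp n F j) m else 0:])"
  define q where "q = (\<Sum>m\<in>Poly_Mapping.keys Q. [:Poly_Mapping.lookup Q m:] * mon_eval h m)"
  have "poly q t = f (shear n i j t F)" for t
  proof -
    have "f (shear n i j t F) = mpol_eval (coeff_vec (shear n i j t F)) Q"
      by (simp add: Q(2) shear_in_Omega F i)
    also have "\<dots> = mpol_eval (\<lambda>v. poly (h v) t) Q"
      using Q(1) by (intro mpol_eval_cong) (auto simp: coord_polys_def coords_def coeff_vec_shear h_def)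
    also have "\<dots> = poly q t"
      by (simp add: q_def mpol_eval_def poly_sum mon_eval_def poly_prod)
    finally show ?thesis by simp
  qed
  then show ?thesis by blast
qed

text \<open>A line \<open>t \<mapsto> shear n i j t F\<close> inside \<open>A \<union> B\<close> lies in \<open>A\<close> or in \<open>B\<close>; the \<open>F\<close> for which
  it lies in \<open>A\<close> form a closed set.\<close>

lemma irreducible_in_shears:
  assumes S: "irreducible_in (zariski n d) S" and i: "i < n"
  shows "irreducible_in (zariski n d) (\<Union>t. shear n i j t ` S)"
  unfolding irreducible_in_def
proof (intro conjI allI impI)
  have SO: "S \<subseteq> Omega n d" "S \<noteq> {}" using S by (auto simp: irreducible_in_def)
  then show "(\<Union>t. shear n i j t ` S) \<subseteq> topspace (zariski n d)" "(\<Union>t. shear n i j t ` S) \<noteq> {}"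
    using shear_in_Omega[OF _ i] by auto
  fix A B
  assume AB: "closedin (zariski n d) A \<and> closedin (zariski n d) B \<and> (\<Union>t. shear n i j t ` S) \<subseteq> A \<union> B"
  define C where "C = (\<lambda>A. {F \<in> Omega n d. \<forall>t. shear n i j t F \<in> A})"
  have closed: "closedin (zariski n d) (C A)" if "closedin (zariski n d) A" for A
  proof -
    obtain R where R: "R \<subseteq> regular_fun n d" "A = {F \<in> Omega n d. \<forall>f\<in>R. f F = 0}"
      using \<open>closedin (zariski n d) A\<close> by (rule closedin_zariskiE)
    define R' where "R' = (\<lambda>(f, t) F. f (shear n i j t F)) ` (R \<times> UNIV)"
    have "(\<forall>t. shear n i j t F \<in> A) \<longleftrightarrow> (\<forall>f\<in>R'. f F = 0)" if "F \<in> Omega n d" for F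
    proof -
      have "(\<forall>t. shear n i j t F \<in> A) \<longleftrightarrow> (\<forall>t. \<forall>f\<in>R. f (shear n i j t F) = 0)"
        using shear_in_Omega[OF that i] by (simp add: R(2))
      also have "\<dots> \<longleftrightarrow> (\<forall>f\<in>R'. f F = 0)"
        by (auto simp: R'_def)
      finally show ?thesis .
    qed
    then have "C A = {F \<in> Omega n d. \<forall>f\<in>R'. f F = 0}"
      unfolding C_def by blast
    moreover have "R' \<subseteq> regular_fun n d"
      using R(1) regular_fun_shear[OF _ i] by (auto simp: R'_def)
    ultimately show ?thesis by (simp add: closedin_zariski_regular)
  qed
  have nonzero: "\<exists>q. q \<noteq> 0 \<and> (\<forall>t. shear n i j t F \<in> A \<longrightarrow> poly q t = 0)"
    if A: "closedin (zariski n d) A" and F: "F \<in> Omega n d" "F \<notin> C A" for A F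
  proof -
    obtain R where R: "R \<subseteq> regular_fun n d" "A = {F \<in> Omega n d. \<forall>f\<in>R. f F = 0}"
      using A by (rule closedin_zariskiE)
    obtain t f where t: "f \<in> R" "f (shear n i j t F) \<noteq> 0"
      using F shear_in_Omega[OF F(1) i] by (auto simp: C_def R(2))
    obtain q where "\<forall>t. poly q t = f (shear n i j t F)"
      using poly_along_shear[OF _ F(1) i] R(1) t(1) by blast
    with t show ?thesis
      by (intro exI[of _ q]) (auto simp: R(2))
  qed
  have "S \<subseteq> C A \<union> C B"
  proof
    fix F assume FS: "F \<in> S"
    show "F \<in> C A \<union> C B"
    proof (rule ccontr)
      assume "F \<notin> C A \<union> C B"
      then obtain p q where "p \<noteq> 0" "\<forall>t. shear n i j t F \<in> A \<longrightarrow> poly p t = 0"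
        and "q \<noteq> 0" "\<forall>t. shear n i j t F \<in> B \<longrightarrow> poly q t = 0"
        using nonzero[of A F] nonzero[of B F] AB FS SO by blast
      \<comment> \<open>Every \<open>t\<close> puts the sheared map into \<open>A\<close> or into
        \<open>B\<close>.\<close>
      moreover from this have "\<forall>t. poly (p * q) t = 0"
        using AB FS by fastforce
      ultimately show False
        using poly_all_0_iff_0[of "p * q"] by simp
    qed
  qed
  then have "S \<subseteq> C A \<or> S \<subseteq> C B"
    using S AB closed[of A] closed[of B] unfolding irreducible_in_def by blast
  then show "(\<Union>t. shear n i j t ` S) \<subseteq> A \<or> (\<Union>t. shear n i j t ` S) \<subseteq> B"
    by (auto simp: C_def)
qed

text \<open>The union of the sheared copies of \<open>Y\<close> stays inside
  \<open>Keller n d\<close> and contains \<open>Y\<close> through \<open>t = 0\<close>, so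
  maximality of \<open>Y\<close> applies.\<close>

lemma component_shear_invariant:
  assumes Y: "irreducible_component_of (subtopology (zariski n d) (Keller n d)) Y"
    and F: "F \<in> Y" and ij: "i < n" "i \<noteq> j"
  shows "shear n i j t F \<in> Y"
proof -
  let ?Z = "\<Union>t. shear n i j t ` Y"
  have irr: "Y \<subseteq> Keller n d" "irreducible_in (zariski n d) Y"
    using Y by (auto simp: irreducible_component_of_def irreducible_in_subtopology)
  have "?Z \<subseteq> Keller n d"
    using irr(1) shear_in_Keller[OF _ ij] by auto
  then have "irreducible_in (subtopology (zariski n d) (Keller n d)) ?Z"
    using irreducible_in_shears[OF irr(2) ij(1)] by (simp add: irreducible_in_subtopology)
  moreover have "Y \<subseteq> ?Z"
  proof
    fix G assume G: "G \<in> Y"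
    then have "shear n i j 0 G = G"
      using irr(1) by (intro shear_0[of _ n d]) (auto simp: Keller_def)
    with G show "G \<in> ?Z" by (metis UNIV_I UN_I imageI)
  qed
  ultimately have "?Z = Y"
    using Y by (auto simp: irreducible_component_of_def)
  with F show ?thesis by blast
qed

section \<open>A long chain of irreducible subsets\<close>

text \<open>By algebraic independence the components of \<open>F\<close> and 1 are linearly
  independent functions, so some evaluation matrix is invertible, and the rows of its inverse are
  the weights \<open>w\<close>. Weighted point evaluations are chosen because they are regular in
  the map.\<close>

lemma dual_point_functionals:
  assumes F: "F \<in> polymaps n" "Jac F = 1"
  shows "\<exists>w xs. \<forall>j\<le>n. \<forall>l\<le>n.
    (\<Sum>b\<le>n. w l b * mpol_eval (xs b) (ext_comp n F j)) = (if l = j then 1 else (0::complex))"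
proof -
  define g where "g = (\<lambda>j x. mpol_eval x (ext_comp n F j))"
  have "\<exists>xs. det (mat (Suc n) (Suc n) (\<lambda>(b, a). g a (xs b))) \<noteq> 0"
  proof (rule ccontr)
    assume "\<not> ?thesis"
    then obtain c where c: "\<exists>a<Suc n. c a \<noteq> 0" "\<And>x. (\<Sum>a<Suc n. c a * g a x) = 0"
      using eval_dets_0_imp_dependent[of "Suc n" g] by blast
    define P :: "(nat, complex) mpol" where "P = (\<Sum>j<n. mconst (c j) * mvar j) + mconst (c n)"
    have P: "mpol_eval x P = (\<Sum>j<n. c j * x j) + c n" for x
      by (simp add: P_def mpol_eval_add mpol_eval_sum mpol_eval_mult)
    have "P = 0"
    proof (rule Jac_1_imp_alg_independent[OF F])
      have "mpol_vars (mconst (c j) * mvar j :: (nat, complex) mpol) \<subseteq> {..<n}" if "j < n" for j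
        by (rule order.trans[OF mpol_vars_mult]) (use that in auto)
      then have "mpol_vars (\<Sum>j<n. mconst (c j) * mvar j :: (nat, complex) mpol) \<subseteq> {..<n}"
        by (intro mpol_vars_sum) auto
      then show "mpol_vars P \<subseteq> {..<n}"
        unfolding P_def using mpol_vars_add by fastforce
      show "mpol_eval (\<lambda>j. mpol_eval x (F $ j)) P = 0" for x
        using c(2)[of x] by (simp add: P g_def ext_comp_def)
    qed
    then have e: "(\<Sum>j<n. c j * x j) + c n = 0" for x
      using P[of x] by simp
    have "c n = 0" using e[of "\<lambda>_. 0"] by simp
    moreover have "c j = 0" if "j < n" for j
      using e[of "\<lambda>k. if k = j then 1 else 0"] that \<open>c n = 0\<close>
      by (simp add: if_distrib[of "\<lambda>y. _ * y"] cong: if_cong)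
    ultimately show False using c(1) by (auto simp: less_Suc_eq)
  qed
  then obtain xs where xs: "det (mat (Suc n) (Suc n) (\<lambda>(b, a). g a (xs b))) \<noteq> 0" by blast
  define M where "M = mat (Suc n) (Suc n) (\<lambda>(b, a). g a (xs b))"
  have M: "M \<in> carrier_mat (Suc n) (Suc n)" by (simp add: M_def)
  define w where "w = (\<lambda>l b. adj_mat M $$ (l, b) / det M)"
  have "(\<Sum>b\<le>n. w l b * mpol_eval (xs b) (ext_comp n F j)) = (if l = j then 1 else 0)"
    if "j \<le> n" "l \<le> n" for j l
  proof -
    have "(adj_mat M * M) $$ (l, j) = (\<Sum>b\<le>n. adj_mat M $$ (l, b) * g j (xs b))"
      using that adj_mat(1)[OF M] M
      by (simp add: scalar_prod_def M_def atLeast0LessThan lessThan_Suc_atMost)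
    moreover have "(adj_mat M * M) $$ (l, j) = (if l = j then det M else 0)"
      using that by (simp add: adj_mat(3)[OF M])
    moreover have "(\<Sum>b\<le>n. w l b * mpol_eval (xs b) (ext_comp n F j)) =
        (\<Sum>b\<le>n. adj_mat M $$ (l, b) * g j (xs b)) / det M"
      by (simp add: w_def g_def sum_divide_distrib)
    ultimately show ?thesis
      using xs by (simp add: M_def)
  qed
  then show ?thesis by blast
qed

section \<open>Towers of shears and the order of the matrix positions\<close>

primrec shear_tower :: "nat \<Rightarrow> (nat \<times> nat) list \<Rightarrow> polymap \<Rightarrow> nat \<Rightarrow> polymap set" where
  "shear_tower n ps F 0 = {F}"
| "shear_tower n ps F (Suc k) = (\<Union>t. shear n (fst (ps ! k)) (snd (ps ! k)) t ` shear_tower n ps F k)"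

text \<open>The off-diagonal positions of an \<open>n\<close> by \<open>n + 1\<close> matrix whose
  last column, with index \<open>n\<close>, holds the translation part.\<close>

definition shear_pairs :: "nat \<Rightarrow> (nat \<times> nat) set" where
  "shear_pairs n = (SIGMA i:{..<n}. {..n} - {i})"

lemma card_shear_pairs: "card (shear_pairs n) = n\<^sup>2"
proof -
  have "card (shear_pairs n) = (\<Sum>i<n. card ({..n} - {i}))"
    unfolding shear_pairs_def by (rule card_SigmaI) auto
  also have "\<dots> = (\<Sum>i<n. n)"
    by (intro sum.cong) auto
  finally show ?thesis by (simp add: power2_eq_square)
qed

text \<open>Upper triangular pairs come first, by increasing row; then the lower triangular ones, by
  decreasing row and column. A row operation with the pair \<open>(i, j)\<close> then keeps the matrix entries
  at all later positions \<open>(i, l)\<close> equal to zero, because \<open>(j, l)\<close> is a later position as well.\<close>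

definition shear_key :: "nat \<Rightarrow> nat \<times> nat \<Rightarrow> nat \<times> nat \<times> nat" where
  "shear_key n = (\<lambda>(i, j). if i < j then (0, i, j) else (1, n - i, n - j))"

lemma shear_order_exists:
  "\<exists>ps. set ps = shear_pairs n \<and> length ps = n\<^sup>2 \<and>
     (\<forall>k<length ps. \<forall>m<length ps. \<forall>i j l. k < m \<longrightarrow> ps ! k = (i, j) \<longrightarrow> ps ! m = (i, l) \<longrightarrow>
        l \<noteq> j \<and> (j < n \<longrightarrow> (\<exists>m'<length ps. k < m' \<and> ps ! m' = (j, l))))"
proof -
  have "finite (shear_pairs n)" by (simp add: shear_pairs_def)
  then obtain qs where qs: "set qs = shear_pairs n" "distinct qs"
    using finite_distinct_list by blast
  define ps where "ps = sort_key (shear_key n) qs"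
  have ps: "set ps = shear_pairs n" "distinct ps"
    using qs by (auto simp: ps_def)
  have mono: "shear_key n (ps ! k) \<le> shear_key n (ps ! m)" if "k \<le> m" "m < length ps" for k m
    using sorted_sort_key[of "shear_key n" qs] that
    by (auto simp: ps_def[symmetric] sorted_iff_nth_mono)
  have "l \<noteq> j \<and> (j < n \<longrightarrow> (\<exists>m'<length ps. k < m' \<and> ps ! m' = (j, l)))"
    if "k < length ps" "m < length ps" "k < m" "ps ! k = (i, j)" "ps ! m = (i, l)" for k m i j l
  proof
    show lj: "l \<noteq> j"
      using nth_eq_iff_index_eq[OF ps(2), of k m] that by auto
    have mem: "(i, j) \<in> shear_pairs n" "(i, l) \<in> shear_pairs n"
      using that nth_mem ps(1) by metis+
    have key: "shear_key n (i, j) \<le> shear_key n (i, l)"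
      using mono[of k m] that by simp
    show "j < n \<longrightarrow> (\<exists>m'<length ps. k < m' \<and> ps ! m' = (j, l))"
    proof
      assume j: "j < n"
      have "(j, l) \<in> shear_pairs n"
        using mem lj j by (auto simp: shear_pairs_def)
      then obtain m' where m': "m' < length ps" "ps ! m' = (j, l)"
        using ps(1) by (metis in_set_conv_nth)
      \<comment> \<open>If i < j, then \<open>(j, l)\<close> is either upper triangular in the later
        row j, or lower triangular and hence later. If j < i, then \<open>(i, l)\<close> can only
        follow when l < j, so \<open>(j, l)\<close> is lower triangular in a smaller row, which
        again comes later.\<close>
      have "shear_key n (i, j) < shear_key n (j, l)"
        using mem lj j key by (auto simp: shear_pairs_def shear_key_def split: if_splits)
      then have "\<not> m' \<le> k"
        using mono[of m' k] that m' by auto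
      with m' show "\<exists>m'<length ps. k < m' \<and> ps ! m' = (j, l)" by auto
    qed
  qed
  moreover have "length ps = n\<^sup>2"
    using distinct_card[OF ps(2)] ps(1) card_shear_pairs by simp
  ultimately show ?thesis using ps(1) by blast
qed

text \<open>The linear functionals \<open>\<lambda>\<^sub>l\<close> dual to the components of \<open>F\<close> and \<open>1\<close> read off the entries of the
  affine map \<open>A\<close> from \<open>A \<circ> F\<close>. Step \<open>k\<close> of the tower is the first one to make entry \<open>ps ! k\<close>
  nonzero.\<close>

lemma shear_tower_separated:
  assumes F: "F \<in> Keller n d"
    and ps: "set ps = shear_pairs n"
      "\<And>k m i j l. k < m \<Longrightarrow> m < length ps \<Longrightarrow> ps ! k = (i, j) \<Longrightarrow> ps ! m = (i, l) \<Longrightarrow>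
        l \<noteq> j \<and> (j < n \<longrightarrow> (\<exists>m'<length ps. k < m' \<and> ps ! m' = (j, l)))"
  shows "\<forall>k<length ps. \<exists>W. closedin (zariski n d) W \<and> shear_tower n ps F k \<subseteq> W \<and>
    \<not> shear_tower n ps F (Suc k) \<subseteq> W"
    and "\<And>k. k \<le> length ps \<Longrightarrow> F \<in> shear_tower n ps F k"
proof -
  have FO: "F \<in> Omega n d" and Fp: "F \<in> polymaps n" "Jac F = 1"
    using F by (auto simp: Keller_def Omega_def)
  have pair: "i < n \<and> j \<le> n \<and> i \<noteq> j" if "k < length ps" "ps ! k = (i, j)" for k i j
  proof -
    have "(i, j) \<in> shear_pairs n" using that ps(1) nth_mem by metis
    then show ?thesis by (auto simp: shear_pairs_def)
  qed
  show F_in: "F \<in> shear_tower n ps F k" if "k \<le> length ps" for k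
    using that
  proof (induction k)
    case (Suc k)
    have "F = shear n (fst (ps ! k)) (snd (ps ! k)) 0 F"
      using shear_0[OF FO] by simp
    then show ?case
      unfolding shear_tower.simps using Suc by (intro UN_I[OF UNIV_I] image_eqI[of _ _ F]) auto
  qed simp
  have tower_Omega: "shear_tower n ps F k \<subseteq> Omega n d" if "k \<le> length ps" for k
    using that
  proof (induction k)
    case (Suc k)
    then show ?case
      using pair[of k "fst (ps ! k)" "snd (ps ! k)"] shear_in_Omega by fastforce
  qed (simp add: FO)
  obtain w xs where dual: "\<And>j l. j \<le> n \<Longrightarrow> l \<le> n \<Longrightarrow>
      (\<Sum>b\<le>n. w l b * mpol_eval (xs b) (ext_comp n F j)) = (if l = j then 1 else (0::complex))"
    using dual_point_functionals[OF Fp] by blast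
  \<comment> \<open>For G = A \<circ> F this is the entry of A in row \<open>i\<close> and column
    \<open>l\<close>, with column \<open>n\<close> the translation part.\<close>
  define a where "a = (\<lambda>i l G. \<Sum>b\<le>n. w l b * mpol_eval (xs b) (ext_comp n G i))"
  have a_F: "a j l F = (if l = j then 1 else 0)" if "j \<le> n" "l \<le> n" for j l
    using dual that by (simp add: a_def)
  \<comment> \<open>Row \<open>n\<close> belongs to the constant component 1, so no shear changes
    it.\<close>
  have a_n: "a n l G = (if l = n then 1 else 0)" if "l \<le> n" for l G
    using a_F[of n l] that by (simp add: a_def ext_comp_def)
  have a_shear: "a k l (shear n i j t G) = a k l G + (if k = i then t * a j l G else 0)"
    if "i < n" for k l i j t G
    using that
    by (auto simp: a_def ext_comp_def shear_def mpol_eval_add mpol_eval_mult algebra_simps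
        sum.distrib sum_distrib_left)
  have a_regular: "a i l \<in> regular_fun n d" if "i < n" for i l
    unfolding a_def using that
    by (auto simp: ext_comp_def intro!: regular_fun_sum regular_fun_mult regular_fun_const regular_fun_eval_at)
  \<comment> \<open>Positions not yet treated, \<open>ps ! k\<close> included, still carry the entry
    0 on stage \<open>k\<close> of the tower.\<close>
  have zero: "a i l G = 0"
    if "k \<le> m" "m < length ps" "ps ! m = (i, l)" "G \<in> shear_tower n ps F k" for k m i l G
    using that
  proof (induction k arbitrary: m i l G)
    case 0
    then show ?case using pair[of m i l] a_F[of i l] by auto
  next
    case (Suc k)
    obtain i' j where ij: "ps ! k = (i', j)" by (cases "ps ! k")
    obtain t H where G: "G = shear n i' j t H" and H: "H \<in> shear_tower n ps F k"
      using Suc.prems(4) ij by auto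
    have k: "k < length ps" "i' < n" "j \<le> n"
      using Suc.prems pair[OF _ ij] by auto
    have "a i l H = 0"
      by (rule Suc.IH[of m]) (use Suc.prems H in simp_all)
    moreover have "a j l H = 0" if "i = i'"
    proof -
      have lj: "l \<noteq> j" "j < n \<longrightarrow> (\<exists>m'<length ps. k < m' \<and> ps ! m' = (j, l))"
        using ps(2)[of k m i j l] Suc.prems ij that by auto
      show ?thesis
      proof (cases "j < n")
        case True
        with lj obtain m' where "m' < length ps" "k < m'" "ps ! m' = (j, l)" by auto
        then show ?thesis
          by (intro Suc.IH[of m']) (use H in simp_all)
      next
        \<comment> \<open>Here \<open>j = n\<close>: the step is a translation, which only affects
          column \<open>n\<close>, while \<open>l\<close> differs from \<open>j\<close>.\<close>
        case False
        then show ?thesis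
          using k lj a_n[of l] pair[OF Suc.prems(2,3)] by simp
      qed
    qed
    ultimately show ?case by (simp add: G a_shear k)
  qed
  show "\<forall>k<length ps. \<exists>W. closedin (zariski n d) W \<and> shear_tower n ps F k \<subseteq> W \<and>
    \<not> shear_tower n ps F (Suc k) \<subseteq> W"
  proof (intro allI impI)
    fix k assume k: "k < length ps"
    obtain i j where ij: "ps ! k = (i, j)" by (cases "ps ! k")
    note p = pair[OF k ij]
    define W where "W = {G \<in> Omega n d. \<forall>f\<in>{a i j}. f G = 0}"
    have "closedin (zariski n d) W"
      unfolding W_def using a_regular p by (intro closedin_zariski_regular) auto
    moreover have "shear_tower n ps F k \<subseteq> W"
      using tower_Omega[of k] zero[OF order.refl k ij] k by (auto simp: W_def)
    \<comment> \<open>All earlier parameters can be 0, so one shear of \<open>F\<close> itself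
      suffices: it adds the diagonal entry 1 of row \<open>j\<close> to an entry that is 0.\<close>
    moreover have "shear n i j 1 F \<in> shear_tower n ps F (Suc k)"
      using F_in[of k] k ij by auto
    moreover have "shear n i j 1 F \<notin> W"
      using p by (simp add: W_def a_shear a_F)
    ultimately show "\<exists>W. closedin (zariski n d) W \<and> shear_tower n ps F k \<subseteq> W \<and>
      \<not> shear_tower n ps F (Suc k) \<subseteq> W" by blast
  qed
qed

text \<open>The sets \<open>S k\<close> need not be closed, and passing to closures could collapse
  the chain. The closed set \<open>W\<close> prevents this: it contains the closure of
  \<open>S k\<close> but not \<open>S (Suc k)\<close>.\<close>

lemma krull_dim_ge:
  assumes "\<And>k. k \<le> N \<Longrightarrow> irreducible_in T (S k) \<and> S k \<subseteq> Y"
    and mono: "\<And>k. k < N \<Longrightarrow> S k \<subseteq> S (Suc k)"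
    and sep: "\<And>k. k < N \<Longrightarrow> \<exists>W. closedin T W \<and> S k \<subseteq> W \<and> \<not> S (Suc k) \<subseteq> W"
  shows "enat N \<le> krull_dim (subtopology T Y)"
proof -
  define Z where "Z = (\<lambda>k. Y \<inter> T closure_of S k)"
  have sub: "S k \<subseteq> Z k" if "k \<le> N" for k
    using assms(1)[OF that] closure_of_subset[of "S k" T] by (auto simp: Z_def irreducible_in_def)
  have "closedin (subtopology T Y) (Z k)" for k
    unfolding Z_def by (metis Int_commute closedin_closure_of closedin_subtopology)
  moreover have "irreducible_in (subtopology T Y) (Z k)" if "k \<le> N" for k
    using irreducible_in_subset_closure[of T "S k" "Z k"] assms(1)[OF that] sub[OF that]
    by (auto simp: irreducible_in_subtopology Z_def)
  moreover have "Z k \<subset> Z (Suc k)" if k: "k < N" for k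
  proof -
    have "Z k \<subseteq> Z (Suc k)"
      unfolding Z_def using closure_of_mono[OF mono[OF k]] by blast
    moreover obtain W where W: "closedin T W" "S k \<subseteq> W" "\<not> S (Suc k) \<subseteq> W"
      using sep[OF k] by blast
    have "Z k \<subseteq> W"
      using closure_of_minimal[OF W(2,1)] by (auto simp: Z_def)
    moreover have "\<not> Z (Suc k) \<subseteq> W"
      using sub[of "Suc k"] W(3) k by auto
    ultimately show ?thesis by blast
  qed
  ultimately have "\<exists>Z. (\<forall>i\<le>N. closedin (subtopology T Y) (Z i) \<and> irreducible_in (subtopology T Y) (Z i)) \<and>
      (\<forall>i<N. Z i \<subset> Z (Suc i))" by blast
  then show ?thesis
    unfolding krull_dim_def by (intro SUP_upper) auto
qed

lemma krull_dim_component_ge: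
  assumes Y: "irreducible_component_of (subtopology (zariski n d) (Keller n d)) Y"
  shows "enat (n\<^sup>2) \<le> krull_dim (subtopology (zariski n d) Y)"
proof -
  have YK: "Y \<subseteq> Keller n d" and Yirr: "irreducible_in (zariski n d) Y"
    using Y by (auto simp: irreducible_component_of_def irreducible_in_subtopology)
  then obtain F where F: "F \<in> Y" "F \<in> Keller n d"
    by (auto simp: irreducible_in_def)
  obtain ps where ps: "set ps = shear_pairs n" "length ps = n\<^sup>2"
    and order: "\<forall>k<length ps. \<forall>m<length ps. \<forall>i j l. k < m \<longrightarrow> ps ! k = (i, j) \<longrightarrow> ps ! m = (i, l) \<longrightarrow>
        l \<noteq> j \<and> (j < n \<longrightarrow> (\<exists>m'<length ps. k < m' \<and> ps ! m' = (j, l)))"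
    using shear_order_exists by blast
  have order': "l \<noteq> j \<and> (j < n \<longrightarrow> (\<exists>m'<length ps. k < m' \<and> ps ! m' = (j, l)))"
    if "k < m" "m < length ps" "ps ! k = (i, j)" "ps ! m = (i, l)" for k m i j l
  proof -
    have "k < length ps" using that by simp
    then show ?thesis by (rule order[rule_format, OF _ that(2,1,3,4)])
  qed
  note sep = shear_tower_separated[OF F(2) ps(1) order']
  have pair: "fst (ps ! k) < n \<and> fst (ps ! k) \<noteq> snd (ps ! k)" if "k < length ps" for k
  proof -
    have "ps ! k \<in> shear_pairs n" using nth_mem[OF that] unfolding ps(1) .
    then show ?thesis by (auto simp: shear_pairs_def)
  qed
  have tower: "irreducible_in (zariski n d) (shear_tower n ps F k) \<and> shear_tower n ps F k \<subseteq> Y"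
    if "k \<le> length ps" for k
    using that
  proof (induction k)
    case 0
    have "F \<in> Omega n d" using F(2) by (simp add: Keller_def)
    then show ?case using F(1) by (auto simp: irreducible_in_def)
  next
    case (Suc k)
    then have "k < length ps" by simp
    from pair[OF this] Suc show ?case
      using irreducible_in_shears[of n d "shear_tower n ps F k" "fst (ps ! k)" "snd (ps ! k)"]
        component_shear_invariant[OF Y] by auto
  qed
  have mono: "shear_tower n ps F k \<subseteq> shear_tower n ps F (Suc k)" if k: "k < length ps" for k
  proof
    fix G assume G: "G \<in> shear_tower n ps F k"
    then have "G \<in> Omega n d"
      using tower[of k] k YK by (auto simp: Keller_def)
    then have "G = shear n (fst (ps ! k)) (snd (ps ! k)) 0 G"
      by (simp add: shear_0)
    then show "G \<in> shear_tower n ps F (Suc k)"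
      unfolding shear_tower.simps using G by (intro UN_I[OF UNIV_I] image_eqI[of _ _ G])
  qed
  show ?thesis
    unfolding ps(2)[symmetric]
  proof (rule krull_dim_ge)
    show "irreducible_in (zariski n d) (shear_tower n ps F k) \<and> shear_tower n ps F k \<subseteq> Y"
      if "k \<le> length ps" for k
      using tower that .
    show "shear_tower n ps F k \<subseteq> shear_tower n ps F (Suc k)" if "k < length ps" for k
      using mono that .
    show "\<exists>W. closedin (zariski n d) W \<and> shear_tower n ps F k \<subseteq> W \<and>
        \<not> shear_tower n ps F (Suc k) \<subseteq> W" if "k < length ps" for k
      using sep(1) that by simp
  qed
qed

section \<open>Assembling the dichotomy and the dimension bound\<close>

theorem theorem2p2:
  fixes n d :: nat and Y :: "polymap set"
  assumes "n \<ge> 1" and "d \<ge> 1"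
    and "irreducible_component_of (subtopology (zariski n d) (Keller n d)) Y"
  shows "((\<forall>F\<in>Y. poly_automorphism n F) \<or>
          (\<exists>U. openin (subtopology (zariski n d) Y) U \<and> U \<noteq> {} \<and>
               (subtopology (zariski n d) Y) closure_of U = Y \<and>
               (\<forall>F\<in>U. JC_counterexample n d F)))
         \<and> krull_dim (subtopology (zariski n d) Y) \<ge> enat (n\<^sup>2 - 1)"
proof
  have YK: "Y \<subseteq> Keller n d" and Yirr: "irreducible_in (zariski n d) Y"
    using assms(3) by (auto simp: irreducible_component_of_def irreducible_in_subtopology)
  obtain A where A: "closedin (zariski n d) A" "\<forall>F\<in>Keller n d. F \<in> A \<longleftrightarrow> poly_automorphism n F"
    using closedin_automorphisms[of n d] by (elim exE conjE)
  \<comment> \<open>The automorphisms in \<open>Y\<close> are exactly its points in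
    \<open>A\<close>, so an empty \<open>U\<close> is the first alternative and a nonempty one is
    dense by irreducibility.\<close>
  define U where "U = Y - A"
  have "openin (subtopology (zariski n d) Y) U"
  proof -
    have "openin (zariski n d) (Omega n d - A)"
      using A(1) by (simp add: closedin_def)
    moreover have "U = (Omega n d - A) \<inter> Y"
      using YK by (auto simp: U_def Keller_def)
    ultimately show ?thesis by (auto simp: openin_subtopology)
  qed
  moreover have "\<forall>F\<in>U. JC_counterexample n d F"
    using A(2) YK by (auto simp: U_def JC_counterexample_def)
  moreover have "\<forall>F\<in>Y. poly_automorphism n F" if "U = {}"
    using that A(2) YK by (auto simp: U_def)
  ultimately show "(\<forall>F\<in>Y. poly_automorphism n F) \<or>
          (\<exists>U. openin (subtopology (zariski n d) Y) U \<and> U \<noteq> {} \<and>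
               (subtopology (zariski n d) Y) closure_of U = Y \<and>
               (\<forall>F\<in>U. JC_counterexample n d F))"
    using irreducible_in_open_dense[OF Yirr, of U] by blast
  \<comment> \<open>The translations make the chain one step longer than the bound requires.\<close>
  have "enat (n\<^sup>2 - 1) \<le> enat (n\<^sup>2)" by simp
  also have "\<dots> \<le> krull_dim (subtopology (zariski n d) Y)"
    by (rule krull_dim_component_ge[OF assms(3)])
  finally show "enat (n\<^sup>2 - 1) \<le> krull_dim (subtopology (zariski n d) Y)" .
qed

end
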